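(* Let $M$ be a smooth compact connected surface, let $f\in\mathcal{F}(M,S^1)$ be a null-homotopic function, and let $\tilde f:M\to\mathbb{R}$ be its universal lift. Then the orbits $\mathcal{O}(f)$ and $\mathcal{O}(\tilde f)$ are homeomorphic, and hence $\mathcal{O}_f(f)$ and $\mathcal{O}_{\tilde f}(\tilde f)$ are homeomorphic.
   Context: Let $P$ denote $\mathbb{R}$ or $S^1$. The class $\mathcal{F}(M,P)$: the set of smooth maps $f\in C^\infty(M,P)$ such that (1) $f$ takes a constant value on each boundary component of $M$; (2) for every critical point $z$ of $f$ there are local coordinates in which $f$ is a homogeneous polynomial $\mathbb{R}^2\to\mathbb{R}$ of degree $\geq 2$ without multiple factors. Orbits: let $\mathcal{D}(M)$ be the group of diffeomorphisms of $M$, acting from the right on $C^\infty(M,P)$ by $(f,h)\mapsto f\circ h$. The orbit of $f$ is $\mathcal{O}(f)=\{f\circ h\mid h\in\mathcal{D}(M)\}$. The space $C^\infty(M,P)$ is endowed with the strong Whitney $C^\infty$-topology and $\mathcal{O}(f)$ with the induced topology; $\mathcal{O}_f(f)$ denotes the connected component of $\mathcal{O}(f)$ containing $f$. A function $f:M\to S^1$ is null-homotopic if it is homotopic to a constant map. Let $p:\mathbb{R}\to S^1$, $p(t)=e^{2\pi i t}$, be the universal covering map. For a null-homotopic $f\in\mathcal{F}(M,S^1)$ a universal lift of $f$ is a smooth function $\tilde f:M\to\mathbb{R}$ with $p\circ\tilde f=f$; it exists, is unique up to the choice of base points, and belongs to $\mathcal{F}(M,\mathbb{R})$. *)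

theory Defs
  imports
    "HOL-Analysis.Analysis"
    "HOL-Computational_Algebra.Polynomial"
    "HOL-Computational_Algebra.Squarefree"
begin

section \<open>Smooth functions on subsets of Euclidean spaces\<close>

text \<open>
  \<open>partials H g [v1, ..., vk] x\<close> is the iterated directional derivative of \<open>g\<close> at \<open>x\<close> along
  \<open>vk\<close>, ..., \<open>v1\<close>, each derivative being taken within \<open>H\<close>. For \<open>H = UNIV\<close> and basis vectors these
  are the usual partial derivatives; for a closed half-space they are the one-sided ones, which on
  the bounding hyperplane agree with the partial derivatives of any smooth extension.
\<close>

fun partials ::
  "'e::euclidean_space set \<Rightarrow> ('e \<Rightarrow> 'f::euclidean_space) \<Rightarrow> 'e list \<Rightarrow> 'e \<Rightarrow> 'f" where
  "partials H g [] x = g x"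
| "partials H g (v # vs) x = frechet_derivative (partials H g vs) (at x within H) v"

definition smooth_on_open ::
  "'e::euclidean_space set \<Rightarrow> ('e \<Rightarrow> 'f::euclidean_space) \<Rightarrow> bool" where
  "smooth_on_open W g \<longleftrightarrow>
     open W \<and> (\<forall>vs. set vs \<subseteq> Basis \<longrightarrow> (\<forall>x\<in>W. partials UNIV g vs differentiable (at x)))"

text \<open>On an arbitrary set, smooth means locally extendable to a smooth function on an open set.\<close>

definition smooth_on ::
  "'e::euclidean_space set \<Rightarrow> ('e \<Rightarrow> 'f::euclidean_space) \<Rightarrow> bool" where
  "smooth_on S g \<longleftrightarrow>
     (\<forall>x\<in>S. \<exists>W G. x \<in> W \<and> smooth_on_open W G \<and> (\<forall>y\<in>W \<inter> S. G y = g y))"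


section \<open>Smooth manifolds with boundary\<close>

type_synonym ('a, 'e) chart = "'a set \<times> ('a \<Rightarrow> 'e)"

text \<open>
  A manifold consists of a topology, a model space \<open>H\<close> (a closed half-space, or \<open>UNIV\<close> for manifolds
  without boundary) and a maximal atlas of charts onto relatively open subsets of \<open>H\<close>. A chart
  \<open>(U, \<phi>)\<close> carries no information outside \<open>U\<close>; its inverse is \<open>inv_into U \<phi>\<close>.
\<close>

record ('a, 'e) manifold =
  mfd_top :: "'a topology"
  mfd_model :: "'e set"
  mfd_charts :: "('a, 'e) chart set"

abbreviation points :: "('a, 'e) manifold \<Rightarrow> 'a set" where
  "points M \<equiv> topspace (mfd_top M)"

definition is_chart ::
  "'a topology \<Rightarrow> 'e::euclidean_space set \<Rightarrow> ('a, 'e) chart \<Rightarrow> bool" where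
  "is_chart X H = (\<lambda>(U, \<phi>).
     openin X U \<and> openin (top_of_set H) (\<phi> ` U) \<and>
     homeomorphic_map (subtopology X U) (top_of_set (\<phi> ` U)) \<phi>)"

definition compatible :: "('a, 'e::euclidean_space) chart \<Rightarrow> ('a, 'e) chart \<Rightarrow> bool" where
  "compatible = (\<lambda>(U, \<phi>) (V, \<psi>).
     smooth_on (\<phi> ` (U \<inter> V)) (\<psi> \<circ> inv_into U \<phi>) \<and>
     smooth_on (\<psi> ` (U \<inter> V)) (\<phi> \<circ> inv_into V \<psi>))"

definition generated_atlas ::
  "'a topology \<Rightarrow> 'e::euclidean_space set \<Rightarrow> ('a, 'e) chart set \<Rightarrow> ('a, 'e) chart set" where
  "generated_atlas X H A = {c. is_chart X H c \<and> (\<forall>d\<in>A. compatible c d)}"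

text \<open>
  The equation for the charts says at once that they are charts, that they are pairwise compatible,
  and that the atlas is maximal.
\<close>

definition smooth_manifold :: "('a, 'e::euclidean_space) manifold \<Rightarrow> bool" where
  "smooth_manifold M \<longleftrightarrow>
     Hausdorff_space (mfd_top M) \<and> second_countable (mfd_top M) \<and>
     (\<Union>(U, \<phi>)\<in>mfd_charts M. U) = points M \<and>
     mfd_charts M = generated_atlas (mfd_top M) (mfd_model M) (mfd_charts M)"

definition half_plane :: "(real \<times> real) set" where
  "half_plane = {(x, y). 0 \<le> y}"

definition smooth_surface :: "('a, real \<times> real) manifold \<Rightarrow> bool" where
  "smooth_surface M \<longleftrightarrow> smooth_manifold M \<and> mfd_model M = half_plane"

definition boundary :: "('a, 'e::euclidean_space) manifold \<Rightarrow> 'a set" where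
  "boundary M = {z. \<exists>(U, \<phi>)\<in>mfd_charts M. z \<in> U \<and> \<phi> z \<in> frontier (mfd_model M)}"

definition real_line :: "(real, real) manifold" where
  "real_line = \<lparr>mfd_top = euclideanreal, mfd_model = UNIV,
     mfd_charts = generated_atlas euclideanreal UNIV {(UNIV, \<lambda>x. x)}\<rparr>"

definition circle_cover :: "real \<Rightarrow> complex" where
  "circle_cover t = exp (2 * of_real pi * \<i> * of_real t)"

text \<open>The smooth structure of the circle is the one making \<open>circle_cover\<close> a local diffeomorphism.\<close>

definition circle :: "(complex, real) manifold" where
  "circle = \<lparr>mfd_top = top_of_set (sphere 0 1), mfd_model = UNIV,
     mfd_charts = generated_atlas (top_of_set (sphere 0 1)) UNIV
       {(circle_cover ` {a<..<a+1}, inv_into {a<..<a+1} circle_cover) |a. True}\<rparr>"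


section \<open>Smooth maps and the strong Whitney topology\<close>

definition in_charts :: "('a, 'e) chart \<Rightarrow> ('b, 'f) chart \<Rightarrow> ('a \<Rightarrow> 'b) \<Rightarrow> 'e \<Rightarrow> 'f" where
  "in_charts = (\<lambda>(U, \<phi>) (V, \<psi>) f. \<psi> \<circ> f \<circ> inv_into U \<phi>)"

text \<open>Maps are taken extensional, so that they are determined by their values on the manifold.\<close>

definition smooth_maps ::
  "('a, 'e::euclidean_space) manifold \<Rightarrow> ('b, 'f::euclidean_space) manifold \<Rightarrow> ('a \<Rightarrow> 'b) set" where
  "smooth_maps M N = {f \<in> extensional (points M).
     continuous_map (mfd_top M) (mfd_top N) f \<and>
     (\<forall>(U, \<phi>)\<in>mfd_charts M. \<forall>(V, \<psi>)\<in>mfd_charts N.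
        smooth_on (\<phi> ` (U \<inter> f -` V)) (in_charts (U, \<phi>) (V, \<psi>) f))}"

definition diffeos :: "('a, 'e::euclidean_space) manifold \<Rightarrow> ('a \<Rightarrow> 'a) set" where
  "diffeos M = {h \<in> smooth_maps M M. bij_betw h (points M) (points M) \<and>
     restrict (inv_into (points M) h) (points M) \<in> smooth_maps M M}"

text \<open>
  A basic neighbourhood of \<open>f\<close> in the strong topology of class \<open>C\<^sup>r\<close> is given by a family of tuples
  \<open>((U, \<phi>), K, (V, \<psi>), \<epsilon>)\<close>, locally finite in \<open>U\<close>, with \<open>K\<close> a compact subset of \<open>U\<close> that \<open>f\<close> maps
  into \<open>V\<close>. The strong topology of class \<open>C\<^sup>\<infinity>\<close> is generated by the neighbourhoods for all finite \<open>r\<close>.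
\<close>

type_synonym ('a, 'e, 'b, 'f) nbhd_datum =
  "('a, 'e) chart \<times> 'a set \<times> ('b, 'f) chart \<times> real"

definition whitney_family ::
  "('a, 'e::euclidean_space) manifold \<Rightarrow> ('b, 'f::euclidean_space) manifold \<Rightarrow> ('a \<Rightarrow> 'b) \<Rightarrow>
   ('a, 'e, 'b, 'f) nbhd_datum set \<Rightarrow> bool" where
  "whitney_family M N f \<Phi> \<longleftrightarrow>
     (\<forall>((U, \<phi>), K, (V, \<psi>), \<epsilon>)\<in>\<Phi>.
        (U, \<phi>) \<in> mfd_charts M \<and> (V, \<psi>) \<in> mfd_charts N \<and>
        compactin (mfd_top M) K \<and> K \<subseteq> U \<and> f ` K \<subseteq> V \<and> \<epsilon> > 0) \<and>
     (\<forall>x\<in>points M. \<exists>W. openin (mfd_top M) W \<and> x \<in> W \<and>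
        finite {((U, \<phi>), d). ((U, \<phi>), d) \<in> \<Phi> \<and> U \<inter> W \<noteq> {}})"

definition whitney_nbhd ::
  "('a, 'e::euclidean_space) manifold \<Rightarrow> ('b, 'f::euclidean_space) manifold \<Rightarrow> ('a \<Rightarrow> 'b) \<Rightarrow>
   ('a, 'e, 'b, 'f) nbhd_datum set \<Rightarrow> nat \<Rightarrow> ('a \<Rightarrow> 'b) set" where
  "whitney_nbhd M N f \<Phi> r = {g \<in> smooth_maps M N.
     \<forall>((U, \<phi>), K, (V, \<psi>), \<epsilon>)\<in>\<Phi>. g ` K \<subseteq> V \<and>
       (\<forall>x\<in>\<phi> ` K. \<forall>vs. set vs \<subseteq> Basis \<and> length vs \<le> r \<longrightarrow>
          norm (partials (mfd_model M) (in_charts (U, \<phi>) (V, \<psi>) f) vs x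
              - partials (mfd_model M) (in_charts (U, \<phi>) (V, \<psi>) g) vs x) < \<epsilon>)}"

definition whitney_topology ::
  "('a, 'e::euclidean_space) manifold \<Rightarrow> ('b, 'f::euclidean_space) manifold \<Rightarrow> ('a \<Rightarrow> 'b) topology"
  where
  "whitney_topology M N = topology_generated_by
     {whitney_nbhd M N f \<Phi> r |f \<Phi> r. f \<in> smooth_maps M N \<and> whitney_family M N f \<Phi>}"

definition orbit :: "('a, 'e::euclidean_space) manifold \<Rightarrow> ('a \<Rightarrow> 'b) \<Rightarrow> ('a \<Rightarrow> 'b) set" where
  "orbit M f = {compose (points M) f h |h. h \<in> diffeos M}"

definition orbit_topology ::
  "('a, 'e::euclidean_space) manifold \<Rightarrow> ('b, 'f::euclidean_space) manifold \<Rightarrow> ('a \<Rightarrow> 'b) \<Rightarrow>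
   ('a \<Rightarrow> 'b) topology" where
  "orbit_topology M N f = subtopology (whitney_topology M N) (orbit M f)"

definition orbit_component_topology ::
  "('a, 'e::euclidean_space) manifold \<Rightarrow> ('b, 'f::euclidean_space) manifold \<Rightarrow> ('a \<Rightarrow> 'b) \<Rightarrow>
   ('a \<Rightarrow> 'b) topology" where
  "orbit_component_topology M N f =
     subtopology (orbit_topology M N f) (connected_component_of_set (orbit_topology M N f) f)"


section \<open>The class \<open>\<F>(M, P)\<close>\<close>

text \<open>
  Polynomials in two variables are elements of \<open>\<real>[x][y]\<close>: the coefficient of \<open>x ^ j * y ^ i\<close> in \<open>F\<close>
  is \<open>coeff (coeff F i) j\<close>.
\<close>

definition homogeneous :: "nat \<Rightarrow> real poly poly \<Rightarrow> bool" where
  "homogeneous n F \<longleftrightarrow> (\<forall>i j. coeff (coeff F i) j \<noteq> 0 \<longrightarrow> i + j = n)"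

definition poly2 :: "real poly poly \<Rightarrow> real \<times> real \<Rightarrow> real" where
  "poly2 F = (\<lambda>(x, y). poly (poly F [:y:]) x)"

definition critical_point ::
  "('a, 'e::euclidean_space) manifold \<Rightarrow> ('b, real) manifold \<Rightarrow> ('a \<Rightarrow> 'b) \<Rightarrow> 'a \<Rightarrow> bool" where
  "critical_point M P f z \<longleftrightarrow> z \<in> points M \<and>
     (\<forall>(U, \<phi>)\<in>mfd_charts M. \<forall>(V, \<psi>)\<in>mfd_charts P. z \<in> U \<and> f z \<in> V \<longrightarrow>
        (in_charts (U, \<phi>) (V, \<psi>) f has_derivative (\<lambda>v. 0)) (at (\<phi> z) within mfd_model M))"

text \<open>
  Charts onto subsets of the half-plane cannot in general be centred at \<open>0\<close>, so the local coordinates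
  at \<open>z\<close> are \<open>\<phi> - \<phi> z\<close>; likewise \<open>\<psi> - \<psi> (f z)\<close> at \<open>f z\<close>. Note that \<open>squarefree F\<close> excludes \<open>F = 0\<close>.
\<close>

definition class_F ::
  "('a, real \<times> real) manifold \<Rightarrow> ('b, real) manifold \<Rightarrow> ('a \<Rightarrow> 'b) set" where
  "class_F M P = {f \<in> smooth_maps M P.
     (\<forall>C\<in>connected_components_of (subtopology (mfd_top M) (boundary M)). f constant_on C) \<and>
     (\<forall>z. critical_point M P f z \<longrightarrow>
        (\<exists>(U, \<phi>)\<in>mfd_charts M. \<exists>(V, \<psi>)\<in>mfd_charts P. \<exists>n F.
           z \<in> U \<and> f ` U \<subseteq> V \<and> 2 \<le> n \<and> homogeneous n F \<and> squarefree F \<and>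
           (\<forall>x\<in>U. \<psi> (f x) - \<psi> (f z) = poly2 F (\<phi> x - \<phi> z))))}"

definition null_homotopic ::
  "('a, 'e) manifold \<Rightarrow> ('b, 'f) manifold \<Rightarrow> ('a \<Rightarrow> 'b) \<Rightarrow> bool" where
  "null_homotopic M N f \<longleftrightarrow>
     (\<exists>c\<in>points N. homotopic_with (\<lambda>g. True) (mfd_top M) (mfd_top N) f (\<lambda>x. c))"

definition universal_lift ::
  "('a, 'e::euclidean_space) manifold \<Rightarrow> ('a \<Rightarrow> complex) \<Rightarrow> ('a \<Rightarrow> real) \<Rightarrow> bool" where
  "universal_lift M f f' \<longleftrightarrow>
     f' \<in> smooth_maps M real_line \<and> (\<forall>x\<in>points M. circle_cover (f' x) = f x)"

end

theory Submission
  imports Defs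
begin

text \<open>
  Composition with the covering map \<open>p = circle_cover\<close> sends \<open>f' \<circ> h\<close> to \<open>f \<circ> h\<close> and thus maps the orbit
  of \<open>f'\<close> onto the orbit of \<open>f\<close>. It is the required homeomorphism.

  It is injective: two lifts of the same map differ by an integer, which is constant as \<open>M\<close> is
  connected, and elements of the orbit of \<open>f'\<close> all have the image of \<open>f'\<close>, a compact set, which does
  not admit a nonzero translation into itself (\<open>cover_map_injective\<close>).

  It is continuous: in charts it is composition with a smooth function of one variable, and on a
  compact set the derivatives of \<open>\<theta> \<circ> b\<close> depend continuously on those of \<open>b\<close>
  (\<open>smooth_close_compose\<close>, \<open>continuous_map_cover_map\<close>). Since \<open>M\<close> is compact, the strong Whitney
  topology is generated by conditions on single compact subsets of charts
  (\<open>continuous_map_into_whitney_topology\<close>).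

  Its inverse is continuous: if \<open>p \<circ> u'\<close> is close to \<open>p \<circ> u\<close>, then \<open>u' - u\<close> is everywhere close to an
  integer, hence close to one integer, and comparing the maxima of \<open>u\<close> and \<open>u'\<close> once more shows that
  this integer is zero (\<open>lifts_with_equal_image_close\<close>). So \<open>u'\<close> is uniformly close to \<open>u\<close>. As \<open>p\<close> is a
  local diffeomorphism, \<open>u\<close> and \<open>u'\<close> are locally the angles of \<open>p \<circ> u\<close> and \<open>p \<circ> u'\<close>, so closeness of the
  derivatives of the composites is closeness of the derivatives of the lifts
  (\<open>cover_map_nbhd_smooth_close\<close>).

  Finally, the homeomorphism sends \<open>f'\<close> to \<open>f\<close>, and so the component of \<open>f'\<close> to that of \<open>f\<close>.
\<close>

section \<open>Smoothness relative to a model space\<close>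

text \<open>
  Derivatives within \<open>H\<close> are unique as soon as every point of \<open>H\<close> is approached inside \<open>H\<close> along
  each coordinate axis. The whole space and the half-plane, with its boundary points, have this
  property.
\<close>

definition axis_thick :: "'e::euclidean_space set \<Rightarrow> bool" where
  "axis_thick H \<longleftrightarrow> (\<forall>x\<in>H. \<forall>i\<in>Basis. \<forall>e>0. \<exists>d. 0 < \<bar>d\<bar> \<and> \<bar>d\<bar> < e \<and> x + d *\<^sub>R i \<in> H)"

text \<open>
  This is smoothness intrinsic to the model space \<open>H\<close>: it is expressed by the same one-sided partial
  derivatives as the Whitney neighbourhoods, so that the derivatives of a composite can be computed
  without choosing smooth extensions across the boundary.
\<close>

definition smooth_within ::
  "'e::euclidean_space set \<Rightarrow> 'e set \<Rightarrow> ('e \<Rightarrow> 'f::euclidean_space) \<Rightarrow> bool" where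
  "smooth_within H S g \<longleftrightarrow> openin (top_of_set H) S \<and>
     (\<forall>vs. set vs \<subseteq> Basis \<longrightarrow> (\<forall>x\<in>S. partials H g vs differentiable (at x within H)))"

lemma axis_thick_UNIV: "axis_thick (UNIV :: 'e::euclidean_space set)"
  unfolding axis_thick_def
proof (intro ballI allI impI)
  fix x i :: 'e and e :: real assume "e > 0"
  then show "\<exists>d. 0 < \<bar>d\<bar> \<and> \<bar>d\<bar> < e \<and> x + d *\<^sub>R i \<in> UNIV"
    by (intro exI[of _ "e / 2"]) auto
qed

lemma axis_thick_half_plane: "axis_thick half_plane"
  unfolding axis_thick_def
proof (intro ballI allI impI)
  fix x i :: "real \<times> real" and e :: real
  assume "x \<in> half_plane" "i \<in> Basis" "e > 0"
  then show "\<exists>d. 0 < \<bar>d\<bar> \<and> \<bar>d\<bar> < e \<and> x + d *\<^sub>R i \<in> half_plane"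
    by (intro exI[of _ "e / 2"]) (auto simp: half_plane_def Basis_prod_def)
qed

lemma frechet_derivative_within_eq:
  fixes g :: "'e::euclidean_space \<Rightarrow> 'f::euclidean_space"
  assumes "axis_thick H" "x \<in> H" "(g has_derivative D) (at x within H)"
  shows "frechet_derivative g (at x within H) = D"
proof (rule frechet_derivative_unique_within)
  show "(g has_derivative frechet_derivative g (at x within H)) (at x within H)"
    using assms(3) frechet_derivative_works differentiable_def by blast
qed (use assms in \<open>auto simp: axis_thick_def\<close>)

lemma smooth_within_UNIV: "smooth_within UNIV W g \<longleftrightarrow> smooth_on_open W g"
  by (simp add: smooth_within_def smooth_on_open_def)

lemma smooth_within_openin: "smooth_within H S g \<Longrightarrow> openin (top_of_set H) S"
  by (simp add: smooth_within_def)

lemma smooth_within_subset_model: "smooth_within H S g \<Longrightarrow> S \<subseteq> H"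
  using openin_imp_subset by (auto simp: smooth_within_def)

lemma smooth_within_differentiable:
  "smooth_within H S g \<Longrightarrow> set vs \<subseteq> Basis \<Longrightarrow> x \<in> S \<Longrightarrow>
     partials H g vs differentiable (at x within H)"
  by (simp add: smooth_within_def)

lemma smooth_within_subset:
  "smooth_within H S g \<Longrightarrow> openin (top_of_set H) T \<Longrightarrow> T \<subseteq> S \<Longrightarrow> smooth_within H T g"
  by (auto simp: smooth_within_def)

lemma partials_Cons: "partials H g (v # vs) = (\<lambda>x. frechet_derivative (partials H g vs) (at x within H) v)"
  by (rule ext) simp

lemma partials_Nil: "partials H g [] = g"
  by (rule ext) simp

text \<open>
  The list is read from the right, so its last entry is the innermost derivative. Inductions on
  \<open>vs @ [v]\<close> therefore replace a function by its first derivative, which is the form the product and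
  chain rules need.
\<close>

lemma partials_append: "partials H g (vs @ [v]) = partials H (partials H g [v]) vs"
  by (induction vs) (simp_all only: append_Nil append_Cons partials_Cons partials_Nil)

lemma has_derivative_cong_openin:
  assumes "openin (top_of_set H) T" "x \<in> T" "\<And>y. y \<in> T \<Longrightarrow> g y = h y"
    "(g has_derivative D) (at x within H)"
  shows "(h has_derivative D) (at x within H)"
proof -
  obtain V where V: "open V" "T = H \<inter> V"
    using assms(1) by (auto simp: openin_open)
  then obtain e where e: "e > 0" "ball x e \<subseteq> V"
    using assms(2) open_contains_ball[of V] by auto
  have x: "x \<in> H" using V(2) assms(2) by simp
  have "g x' = h x'" if "x' \<in> H" "dist x' x < e" for x'
    using that e(2) V(2) assms(3)[of x'] by (auto simp: dist_commute mem_ball subset_iff)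
  then show ?thesis by (rule has_derivative_transform_within[OF assms(4) e(1) x])
qed

lemma frechet_derivative_cong_openin:
  assumes "openin (top_of_set H) T" "x \<in> T" "\<And>y. y \<in> T \<Longrightarrow> g y = h y"
  shows "frechet_derivative g (at x within H) = frechet_derivative h (at x within H)"
proof -
  have "(g has_derivative D) (at x within H) \<longleftrightarrow> (h has_derivative D) (at x within H)" for D
    using has_derivative_cong_openin[OF assms(1,2), of g h D]
      has_derivative_cong_openin[OF assms(1,2), of h g D] assms(3) by auto
  then show ?thesis by (simp add: frechet_derivative_def)
qed

text \<open>
  Partial derivatives are local. This is why the arbitrary values of a chart expression outside the
  image of the chart domain never matter.
\<close>

lemma partials_cong_openin:
  assumes "openin (top_of_set H) T" "\<And>y. y \<in> T \<Longrightarrow> g y = h y" "x \<in> T"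
  shows "partials H g vs x = partials H h vs x"
  using assms(3)
proof (induction vs arbitrary: x)
  case Nil
  then show ?case using assms(2) by simp
next
  case (Cons v vs)
  have "frechet_derivative (partials H g vs) (at x within H) =
      frechet_derivative (partials H h vs) (at x within H)"
    using Cons by (intro frechet_derivative_cong_openin[OF assms(1)])
  then show ?case by simp
qed

lemma smooth_within_locally:
  assumes "\<And>x. x \<in> S \<Longrightarrow> \<exists>T h. x \<in> T \<and> T \<subseteq> S \<and> smooth_within H T h \<and> (\<forall>y\<in>T. h y = g y)"
  shows "smooth_within H S g"
  unfolding smooth_within_def
proof (intro conjI allI impI ballI)
  show "openin (top_of_set H) S"
    using assms by (subst openin_subopen) (meson smooth_within_openin)
next
  fix vs :: "'a list" and x
  assume vs: "set vs \<subseteq> Basis" and "x \<in> S"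
  then obtain T h where T: "x \<in> T" "smooth_within H T h" "\<forall>y\<in>T. h y = g y"
    using assms by blast
  have "partials H h vs y = partials H g vs y" if "y \<in> T" for y
    using partials_cong_openin[OF smooth_within_openin[OF T(2)], of h g y vs] T(3) that by auto
  then show "partials H g vs differentiable (at x within H)"
    using has_derivative_cong_openin[OF smooth_within_openin[OF T(2)] T(1)]
      smooth_within_differentiable[OF T(2) vs T(1)]
    unfolding differentiable_def by meson
qed

lemma smooth_within_partial:
  assumes "smooth_within H S g" "v \<in> Basis"
  shows "smooth_within H S (partials H g [v])"
  unfolding smooth_within_def partials_append[symmetric]
  using assms by (auto simp: smooth_within_def)

lemma smooth_within_continuous_on:
  assumes "smooth_within H S g" "set vs \<subseteq> Basis"
  shows "continuous_on S (partials H g vs)"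
  unfolding continuous_on_eq_continuous_within
  using smooth_within_differentiable[OF assms] smooth_within_subset_model[OF assms(1)]
  by (blast intro: continuous_within_subset differentiable_imp_continuous_within)

text \<open>
  Near each point the given function is the restriction of a smooth function on an open set, and the
  full derivative of the latter is also a derivative within \<open>H\<close>; by uniqueness the partial derivatives
  of the two notions agree on the relatively open set, to all orders by induction.
\<close>

lemma smooth_on_imp_smooth_within:
  fixes g :: "'e::euclidean_space \<Rightarrow> 'f::euclidean_space"
  assumes "axis_thick H" "openin (top_of_set H) S" "smooth_on S g"
  shows "smooth_within H S g"
proof (rule smooth_within_locally)
  fix x assume "x \<in> S"
  then obtain W G where W: "x \<in> W" "smooth_on_open W G" "\<forall>y\<in>W \<inter> S. G y = g y"
    using assms(3) unfolding smooth_on_def by blast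
  let ?T = "W \<inter> S"
  have T: "openin (top_of_set H) ?T"
    using assms(2) W(2) by (metis Int_commute openin_Int_open smooth_on_open_def)
  have D: "(partials H G vs has_derivative frechet_derivative (partials UNIV G vs) (at y)) (at y within H)
          \<and> partials H G vs y = partials UNIV G vs y"
    if "set vs \<subseteq> Basis" "y \<in> ?T" for vs y
    using that
  proof (induction vs arbitrary: y)
    case Nil
    then have "G differentiable (at y)"
      using W(2) unfolding smooth_on_open_def
      by (metis IntD1 empty_subsetI list.set(1) partials_Nil)
    then show ?case
      by (simp add: partials_Nil frechet_derivative_works has_derivative_at_withinI)
  next
    case (Cons v vs)
    have eq: "partials H G (v # vs) z = partials UNIV G (v # vs) z" if "z \<in> ?T" for z
    proof -
      have z: "z \<in> H" using openin_imp_subset[OF T] that by blast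
      have "(partials H G vs has_derivative frechet_derivative (partials UNIV G vs) (at z)) (at z within H)"
        using Cons.IH[OF _ that] Cons.prems(1) by simp
      from frechet_derivative_within_eq[OF assms(1) z this] show ?thesis by simp
    qed
    have "partials UNIV G (v # vs) differentiable (at y)"
      using W(2) Cons.prems unfolding smooth_on_open_def by blast
    then have "(partials UNIV G (v # vs) has_derivative
        frechet_derivative (partials UNIV G (v # vs)) (at y)) (at y within H)"
      by (meson frechet_derivative_works has_derivative_at_withinI)
    then show ?case
      using has_derivative_cong_openin[OF T Cons.prems(2)] eq Cons.prems(2) by metis
  qed
  have "smooth_within H ?T G"
    unfolding smooth_within_def using T D differentiable_def by blast
  then show "\<exists>T h. x \<in> T \<and> T \<subseteq> S \<and> smooth_within H T h \<and> (\<forall>y\<in>T. h y = g y)"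
    using W \<open>x \<in> S\<close> by (intro exI[of _ ?T] exI[of _ G]) auto
qed

lemma smooth_on_open_iff: "open W \<Longrightarrow> smooth_on W g \<longleftrightarrow> smooth_on_open W g"
proof
  assume "open W" "smooth_on W g"
  then show "smooth_on_open W g"
    using smooth_on_imp_smooth_within[OF axis_thick_UNIV] smooth_within_UNIV by fastforce
next
  assume "smooth_on_open W g"
  then show "smooth_on W g" unfolding smooth_on_def by blast
qed

section \<open>Sums, products and compositions\<close>

text \<open>
  A sequence is indexed by \<open>Some n\<close> and its limit by \<open>None\<close>, so that one statement speaks of the
  smoothness of all terms and of the limit. The domains may depend on the index because a composite
  \<open>\<theta> \<circ> b\<^sub>n\<close> is only defined where \<open>b\<^sub>n\<close> takes values in the domain of \<open>\<theta>\<close>. With \<open>K = {}\<close> and a constant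
  family this is mere smoothness.
\<close>

definition smooth_convergent ::
  "'e::euclidean_space set \<Rightarrow> (nat option \<Rightarrow> 'e set) \<Rightarrow> 'e set \<Rightarrow>
   (nat option \<Rightarrow> 'e \<Rightarrow> real) \<Rightarrow> bool" where
  "smooth_convergent H S K b \<longleftrightarrow> (\<forall>i. smooth_within H (S i) (b i)) \<and>
     (\<forall>vs. set vs \<subseteq> Basis \<longrightarrow>
        uniform_limit K (\<lambda>n. partials H (b (Some n)) vs) (partials H (b None) vs) sequentially)"

text \<open>
  Being smooth and convergent with all derivatives is the largest property that implies
  differentiability and uniform convergence and passes to first partial derivatives. A class of
  families that is closed under differentiation thus needs to be checked in order \<open>0\<close> and \<open>1\<close> only.
\<close>

lemma smooth_convergent_coinduct:
  assumes "P b"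
    and S: "\<And>i. openin (top_of_set H) (S i)" "\<And>i. K \<subseteq> S i"
    and diff: "\<And>b i x. P b \<Longrightarrow> x \<in> S i \<Longrightarrow> b i differentiable (at x within H)"
    and lim: "\<And>b. P b \<Longrightarrow> uniform_limit K (\<lambda>n. b (Some n)) (b None) sequentially"
    and step: "\<And>b v. P b \<Longrightarrow> v \<in> Basis \<Longrightarrow>
      \<exists>c. P c \<and> (\<forall>i. \<forall>x\<in>S i. partials H (b i) [v] x = c i x)"
  shows "smooth_convergent H S K b"
proof -
  have "(\<forall>i. \<forall>x\<in>S i. partials H (b i) vs differentiable (at x within H)) \<and>
        uniform_limit K (\<lambda>n. partials H (b (Some n)) vs) (partials H (b None) vs) sequentially"
    if "set vs \<subseteq> Basis" "P b" for vs b
    using that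
  proof (induction vs arbitrary: b rule: rev_induct)
    case Nil
    then show ?case using diff lim by (simp add: partials_Nil)
  next
    case (snoc v vs)
    then obtain c where c: "P c" "\<And>i x. x \<in> S i \<Longrightarrow> partials H (b i) [v] x = c i x"
      using step[of b v] by auto
    have eq: "partials H (b i) (vs @ [v]) x = partials H (c i) vs x" if "x \<in> S i" for i x
      unfolding partials_append by (rule partials_cong_openin[OF S(1)[of i] c(2) that])
    have IH: "\<And>i x. x \<in> S i \<Longrightarrow> partials H (c i) vs differentiable (at x within H)"
      "uniform_limit K (\<lambda>n. partials H (c (Some n)) vs) (partials H (c None) vs) sequentially"
      using snoc.IH[OF _ c(1)] snoc.prems by auto
    have "partials H (b i) (vs @ [v]) differentiable (at x within H)" if "x \<in> S i" for i x
      using IH(1)[OF that] has_derivative_cong_openin[OF S(1) that, of "partials H (c i) vs"] eq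
      unfolding differentiable_def by metis
    moreover have "uniform_limit K (\<lambda>n. partials H (b (Some n)) (vs @ [v]))
        (partials H (b None) (vs @ [v])) sequentially"
      using IH(2) S(2) eq by (subst uniform_limit_cong'[where g = "\<lambda>n. partials H (c (Some n)) vs"
          and i = "partials H (c None) vs"]) (auto simp: subset_iff)
    ultimately show ?case by blast
  qed
  then show ?thesis
    using assms(1) S(1) unfolding smooth_convergent_def smooth_within_def by blast
qed

text \<open>
  The algebra generated by convergent families and their composites with smooth functions of one
  variable. It is closed under differentiation, since \<open>\<partial>(\<theta> \<circ> b) = (\<theta>' \<circ> b) * \<partial>b\<close> is again a product of
  members; the composites alone would not be. No bookkeeping of orders of differentiability arises.
\<close>

inductive generated_family ::
  "'e::euclidean_space set \<Rightarrow> (nat option \<Rightarrow> 'e set) \<Rightarrow> 'e set \<Rightarrow>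
   (nat option \<Rightarrow> 'e \<Rightarrow> real) \<Rightarrow> bool" for H S K where
  base: "smooth_convergent H S K b \<Longrightarrow> generated_family H S K b"
| add: "generated_family H S K b \<Longrightarrow> generated_family H S K c \<Longrightarrow>
    generated_family H S K (\<lambda>i x. b i x + c i x)"
| mult: "generated_family H S K b \<Longrightarrow> generated_family H S K c \<Longrightarrow>
    generated_family H S K (\<lambda>i x. b i x * c i x)"
| comp: "smooth_convergent H S K b \<Longrightarrow> smooth_on_open \<Omega> \<theta> \<Longrightarrow> (\<And>i. b i ` S i \<subseteq> \<Omega>) \<Longrightarrow>
    generated_family H S K (\<lambda>i x. \<theta> (b i x))"

lemma smooth_convergent_imp_uniform_limit:
  assumes "smooth_convergent H S K b"
  shows "uniform_limit K (\<lambda>n. b (Some n)) (b None) sequentially"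
proof -
  have "uniform_limit K (\<lambda>n. partials H (b (Some n)) []) (partials H (b None) []) sequentially"
    using assms unfolding smooth_convergent_def by simp
  then show ?thesis by (simp only: partials_Nil)
qed

lemma smooth_convergent_partial:
  assumes "smooth_convergent H S K b" "v \<in> Basis"
  shows "smooth_convergent H S K (\<lambda>i. partials H (b i) [v])"
  unfolding smooth_convergent_def
proof (intro conjI allI impI)
  show "smooth_within H (S i) (partials H (b i) [v])" for i
    using assms by (simp add: smooth_convergent_def smooth_within_partial)
  fix vs :: "'a list" assume "set vs \<subseteq> Basis"
  then have "set (vs @ [v]) \<subseteq> Basis" using assms(2) by simp
  then show "uniform_limit K (\<lambda>n. partials H (partials H (b (Some n)) [v]) vs)
      (partials H (partials H (b None) [v]) vs) sequentially"
    using assms(1) unfolding smooth_convergent_def partials_append[symmetric] by blast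
qed

text \<open>
  The values of the limit form a compact subset of \<open>\<Omega>\<close>, hence have a compact neighbourhood in \<open>\<Omega>\<close>, on
  which \<open>\<theta>\<close> is uniformly continuous and into which all late terms of the sequence map.
\<close>

lemma uniform_limit_continuous_compose:
  fixes \<theta> :: "'b::euclidean_space \<Rightarrow> 'c::metric_space"
  assumes lim: "uniform_limit K g l F" and "compact (l ` K)"
    and "open \<Omega>" "l ` K \<subseteq> \<Omega>" "continuous_on \<Omega> \<theta>"
  shows "uniform_limit K (\<lambda>n x. \<theta> (g n x)) (\<lambda>x. \<theta> (l x)) F"
proof -
  obtain e where e: "e > 0" "(\<Union>y\<in>l ` K. cball y e) \<subseteq> \<Omega>"
    using compact_subset_open_imp_cball_epsilon_subset assms by metis
  let ?B = "\<Union>y\<in>l ` K. cball y e"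
  have B: "?B = {y + z |y z. y \<in> l ` K \<and> z \<in> cball 0 e}"
  proof safe
    fix x y assume "x \<in> K" "y \<in> cball (l x) e"
    then show "\<exists>y' z. y = y' + z \<and> y' \<in> l ` K \<and> z \<in> cball 0 e"
      by (intro exI[of _ "l x"] exI[of _ "y - l x"]) (auto simp: dist_norm norm_minus_commute)
  next
    fix x and z :: 'b assume "x \<in> K" "z \<in> cball 0 e"
    then show "l x + z \<in> (\<Union>y\<in>l ` K. cball y e)"
      by (auto simp: dist_norm intro!: bexI[of _ x])
  qed
  have cB: "compact ?B"
    unfolding B by (intro compact_sums assms compact_cball)
  have "uniformly_continuous_on ?B \<theta>"
    using cB e assms(5) by (meson compact_uniformly_continuous continuous_on_subset)
  moreover have "eventually (\<lambda>n. \<forall>x\<in>K. g n x \<in> ?B) F"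
    using uniform_limitD[OF lim e(1)]
    by eventually_elim (auto simp: dist_commute intro: less_imp_le)
  ultimately show ?thesis
    using uniform_limit_compose_uniformly_continuous_on[OF lim] compact_imp_closed[OF cB] by blast
qed

lemma derivative_compose_real:
  fixes \<theta> :: "real \<Rightarrow> real" and g :: "'e::euclidean_space \<Rightarrow> real"
  assumes H: "axis_thick H" and g: "smooth_within H S g" "x \<in> S"
    and \<theta>: "smooth_on_open \<Omega> \<theta>" "g x \<in> \<Omega>"
  shows "((\<lambda>x. \<theta> (g x)) has_derivative (\<lambda>v. partials UNIV \<theta> [1] (g x) * partials H g [v] x))
           (at x within H)"
proof -
  have g': "(g has_derivative (\<lambda>v. partials H g [v] x)) (at x within H)"
    using smooth_within_differentiable[OF g(1), of "[]"] g(2)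
    by (simp add: partials_Nil frechet_derivative_works[symmetric])
  have d: "\<theta> differentiable (at (g x))"
    using \<theta> unfolding smooth_on_open_def by (metis empty_subsetI list.set(1) partials_Nil)
  have "frechet_derivative \<theta> (at (g x)) = (\<lambda>y. partials UNIV \<theta> [1] (g x) * y)"
  proof
    show "frechet_derivative \<theta> (at (g x)) y = partials UNIV \<theta> [1] (g x) * y" for y
      using linear_cmul[OF linear_frechet_derivative[OF d], of y 1] by (simp add: partials_Nil)
  qed
  then have "(\<theta> has_derivative (\<lambda>y. partials UNIV \<theta> [1] (g x) * y)) (at (g x))"
    using d unfolding frechet_derivative_works by simp
  from has_derivative_compose[OF g' this] show ?thesis .
qed

lemma partials_single_eq:
  "axis_thick H \<Longrightarrow> x \<in> H \<Longrightarrow> (g has_derivative D) (at x within H) \<Longrightarrow> partials H g [v] x = D v"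
  by (simp add: partials_Nil frechet_derivative_within_eq)

lemma has_derivative_partials_single:
  "g differentiable (at x within H) \<Longrightarrow>
     (g has_derivative (\<lambda>v. partials H g [v] x)) (at x within H)"
  by (simp add: partials_Nil frechet_derivative_works[symmetric])

lemma smooth_convergent_generated:
  assumes H: "axis_thick H" and K: "compact K"
    and S: "\<And>i. openin (top_of_set H) (S i)" "\<And>i. K \<subseteq> S i"
    and "generated_family H S K b"
  shows "smooth_convergent H S K b"
proof (rule smooth_convergent_coinduct[where P = "generated_family H S K", OF assms(5) S])
  have SH: "x \<in> H" if "x \<in> S i" for x i
    using S(1) that openin_imp_subset by blast
  show diff: "b i differentiable (at x within H)" if "generated_family H S K b" "x \<in> S i" for b i x
    using that
  proof induction
    case (base b)
    then show ?case
      using smooth_within_differentiable[of H "S i" "b i" "[]" x]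
      by (simp add: smooth_convergent_def partials_Nil)
  next
    case (comp b \<Omega> \<theta>)
    then show ?case
      using derivative_compose_real[OF H, of "S i" "b i" x \<Omega> \<theta>]
      unfolding smooth_convergent_def differentiable_def by blast
  qed (simp_all add: differentiable_add differentiable_mult)
  have bounded: "compact (b None ` K)" if "generated_family H S K b" for b
  proof (rule compact_continuous_image[OF _ K])
    have "continuous (at x within H) (b None)" if "x \<in> K" for x
      using diff[OF \<open>generated_family H S K b\<close>] S(2) that differentiable_imp_continuous_within by blast
    moreover have "K \<subseteq> H" using S(2)[of None] SH by blast
    ultimately show "continuous_on K (b None)"
      unfolding continuous_on_eq_continuous_within by (blast intro: continuous_within_subset)
  qed
  show "uniform_limit K (\<lambda>n. b (Some n)) (b None) sequentially" if "generated_family H S K b" for b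
    using that
  proof induction
    case (base b)
    then show ?case by (rule smooth_convergent_imp_uniform_limit)
  next
    case (add b c)
    then show ?case by (intro uniform_limit_add)
  next
    case (mult b c)
    then show ?case by (intro uniform_lim_mult compact_imp_bounded bounded)
  next
    case (comp b \<Omega> \<theta>)
    have lim: "uniform_limit K (\<lambda>n. b (Some n)) (b None) sequentially"
      using smooth_convergent_imp_uniform_limit[OF comp(1)] .
    have "continuous_on \<Omega> \<theta>"
      using smooth_within_continuous_on[of UNIV \<Omega> \<theta> "[]"] comp(2)
      by (simp add: smooth_within_UNIV partials_Nil)
    moreover have "b None ` K \<subseteq> \<Omega>" using comp(3) S(2) by blast
    moreover have "open \<Omega>" using comp(2) by (simp add: smooth_on_open_def)
    moreover have "compact (b None ` K)" by (rule bounded[OF generated_family.base[OF comp(1)]])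
    ultimately show ?case by (intro uniform_limit_continuous_compose[OF lim])
  qed
  show "\<exists>c. generated_family H S K c \<and> (\<forall>i. \<forall>x\<in>S i. partials H (b i) [v] x = c i x)"
    if "generated_family H S K b" "v \<in> Basis" for b v
    using that
  proof induction
    case (base b)
    then show ?case
      by (intro exI[of _ "\<lambda>i. partials H (b i) [v]"] conjI generated_family.base
          smooth_convergent_partial) simp_all
  next
    case (add b c)
    then obtain b' c' where *: "generated_family H S K b'" "generated_family H S K c'"
      "\<And>i x. x \<in> S i \<Longrightarrow> partials H (b i) [v] x = b' i x"
      "\<And>i x. x \<in> S i \<Longrightarrow> partials H (c i) [v] x = c' i x" by blast
    have "partials H (\<lambda>x. b i x + c i x) [v] x = b' i x + c' i x" if x: "x \<in> S i" for i x
      using partials_single_eq[OF H SH[OF x] has_derivative_add[OF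
        has_derivative_partials_single[OF diff[OF add(1) x]] has_derivative_partials_single[OF diff[OF add(2) x]]]]
        *(3,4)[OF x] by simp
    then show ?case
      by (intro exI[of _ "\<lambda>i x. b' i x + c' i x"] conjI generated_family.add[OF *(1,2)]) simp
  next
    case (mult b c)
    then obtain b' c' where *: "generated_family H S K b'" "generated_family H S K c'"
      "\<And>i x. x \<in> S i \<Longrightarrow> partials H (b i) [v] x = b' i x"
      "\<And>i x. x \<in> S i \<Longrightarrow> partials H (c i) [v] x = c' i x" by blast
    have "partials H (\<lambda>x. b i x * c i x) [v] x = b i x * c' i x + b' i x * c i x" if x: "x \<in> S i" for i x
      using partials_single_eq[OF H SH[OF x] has_derivative_mult[OF
        has_derivative_partials_single[OF diff[OF mult(1) x]] has_derivative_partials_single[OF diff[OF mult(2) x]]]]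
        *(3,4)[OF x] by simp
    moreover have "generated_family H S K (\<lambda>i x. b i x * c' i x + b' i x * c i x)"
      by (intro generated_family.add generated_family.mult * mult)
    ultimately show ?case
      by (intro exI[of _ "\<lambda>i x. b i x * c' i x + b' i x * c i x"]) simp
  next
    case (comp b \<Omega> \<theta>)
    have \<theta>': "smooth_on_open \<Omega> (partials UNIV \<theta> [1])"
      using smooth_within_partial[of UNIV \<Omega> \<theta> 1] comp(2) by (simp add: smooth_within_UNIV)
    have "partials H (\<lambda>x. \<theta> (b i x)) [v] x = partials UNIV \<theta> [1] (b i x) * partials H (b i) [v] x"
      if x: "x \<in> S i" for i x
      using comp(1) comp(3)[of i] x unfolding smooth_convergent_def
      by (intro partials_single_eq[OF H SH[OF x]] derivative_compose_real[OF H _ x comp(2)]) auto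
    moreover have "generated_family H S K (\<lambda>i x. partials UNIV \<theta> [1] (b i x) * partials H (b i) [v] x)"
      using generated_family.mult[OF generated_family.comp[OF comp(1) \<theta>' comp(3)]
          generated_family.base[OF smooth_convergent_partial[OF comp(1,4)]]] .
    ultimately show ?case
      by (intro exI[of _ "\<lambda>i x. partials UNIV \<theta> [1] (b i x) * partials H (b i) [v] x"]) simp
  qed
qed

text \<open>
  The case of a constant family and an empty \<open>K\<close>, where convergence says nothing.
\<close>

lemma smooth_within_compose:
  fixes \<theta> :: "real \<Rightarrow> real" and g :: "'e::euclidean_space \<Rightarrow> real"
  assumes "axis_thick H" "smooth_within H S g" "smooth_on_open \<Omega> \<theta>" "g ` S \<subseteq> \<Omega>"
  shows "smooth_within H S (\<lambda>x. \<theta> (g x))"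
proof -
  have "smooth_convergent H (\<lambda>_. S) {} (\<lambda>_. g)"
    using assms(2) by (simp add: smooth_convergent_def)
  then have "generated_family H (\<lambda>_. S) {} (\<lambda>_ x. \<theta> (g x))"
    using generated_family.comp[where b = "\<lambda>_. g"] assms(3,4) by blast
  then have "smooth_convergent H (\<lambda>_. S) {} (\<lambda>_ x. \<theta> (g x))"
    using assms(1) smooth_within_openin[OF assms(2)]
    by (intro smooth_convergent_generated) simp_all
  then show ?thesis by (simp add: smooth_convergent_def)
qed

lemma smooth_on_compose:
  fixes \<theta> :: "real \<Rightarrow> real" and g :: "'e::euclidean_space \<Rightarrow> real"
  assumes g: "smooth_on S g" and \<theta>: "smooth_on_open \<Omega> \<theta>" and "g ` S \<subseteq> \<Omega>"
  shows "smooth_on S (\<theta> \<circ> g)"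
  unfolding smooth_on_def
proof
  fix x assume "x \<in> S"
  then obtain W G where W: "x \<in> W" "smooth_on_open W G" "\<forall>y\<in>W \<inter> S. G y = g y"
    using g unfolding smooth_on_def by blast
  let ?W = "W \<inter> G -` \<Omega>"
  have "continuous_on W G"
    using smooth_within_continuous_on[of UNIV W G "[]"] W(2)
    by (simp add: smooth_within_UNIV partials_Nil)
  then have "open ?W"
    using W(2) \<theta> unfolding smooth_on_open_def by (meson continuous_open_preimage)
  then have "smooth_within UNIV ?W G"
    using W(2) by (auto simp: smooth_within_UNIV smooth_on_open_def)
  then have "smooth_on_open ?W (\<lambda>y. \<theta> (G y))"
    using smooth_within_compose[OF axis_thick_UNIV _ \<theta>] by (auto simp: smooth_within_UNIV)
  moreover have "G x \<in> \<Omega>" using W \<open>x \<in> S\<close> assms(3) by auto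
  ultimately show "\<exists>W G. x \<in> W \<and> smooth_on_open W G \<and> (\<forall>y\<in>W \<inter> S. G y = (\<theta> \<circ> g) y)"
    using W by (intro exI[of _ ?W] exI[of _ "\<lambda>y. \<theta> (G y)"]) auto
qed

lemma smooth_on_locally:
  assumes "\<And>x. x \<in> S \<Longrightarrow> \<exists>W h. open W \<and> x \<in> W \<and> smooth_on (W \<inter> S) h \<and> (\<forall>y\<in>W \<inter> S. h y = g y)"
  shows "smooth_on S g"
  unfolding smooth_on_def
proof
  fix x assume x: "x \<in> S"
  then obtain W h where W: "open W" "x \<in> W" "smooth_on (W \<inter> S) h" "\<forall>y\<in>W \<inter> S. h y = g y"
    using assms by blast
  then obtain V G where V: "x \<in> V" "smooth_on_open V G" "\<forall>y\<in>V \<inter> (W \<inter> S). G y = h y"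
    using x unfolding smooth_on_def by blast
  have "smooth_on_open (V \<inter> W) G"
    using V(2) W(1) by (auto simp: smooth_on_open_def)
  then show "\<exists>W G. x \<in> W \<and> smooth_on_open W G \<and> (\<forall>y\<in>W \<inter> S. G y = g y)"
    using V W by (intro exI[of _ "V \<inter> W"] exI[of _ G]) auto
qed

text \<open>
  Composition with \<open>\<theta>\<close> is continuous for closeness of all derivatives on a compact set. The order \<open>r'\<close>
  is not controlled in terms of \<open>r\<close>; for the topology of class \<open>C\<^sup>\<infinity>\<close> any order will do, and this allows a
  proof by contradiction: functions that are \<open>1/n\<close>-close in order \<open>n\<close> but whose composites stay apart
  would form a sequence that converges with all derivatives.
\<close>

lemma smooth_close_compose:
  fixes \<theta> :: "real \<Rightarrow> real" and a :: "'e::euclidean_space \<Rightarrow> real"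
  assumes H: "axis_thick H" and K: "compact K" "K \<subseteq> S" and a: "smooth_within H S a"
    and \<theta>: "smooth_on_open \<Omega> \<theta>" and aK: "a ` K \<subseteq> \<Omega>" and "\<epsilon> > 0"
  obtains \<delta> r' where "\<delta> > 0"
    "\<And>b x. smooth_within H S b \<Longrightarrow>
       (\<And>x vs. x \<in> K \<Longrightarrow> set vs \<subseteq> Basis \<Longrightarrow> length vs \<le> r' \<Longrightarrow>
          norm (partials H a vs x - partials H b vs x) < \<delta>) \<Longrightarrow> x \<in> K \<Longrightarrow>
       b x \<in> \<Omega> \<and> (\<forall>vs. set vs \<subseteq> Basis \<and> length vs \<le> r \<longrightarrow>
         norm (partials H (\<theta> \<circ> a) vs x - partials H (\<theta> \<circ> b) vs x) < \<epsilon>)"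
proof -
  define close where "close \<delta> r' b \<longleftrightarrow> (\<forall>x\<in>K. \<forall>vs. set vs \<subseteq> Basis \<and> length vs \<le> r' \<longrightarrow>
      norm (partials H a vs x - partials H b vs x) < \<delta>)" for \<delta> :: real and r' b
  define good where "good b x \<longleftrightarrow> b x \<in> \<Omega> \<and> (\<forall>vs. set vs \<subseteq> Basis \<and> length vs \<le> r \<longrightarrow>
      norm (partials H (\<theta> \<circ> a) vs x - partials H (\<theta> \<circ> b) vs x) < \<epsilon>)" for b x
  have "\<exists>\<delta>>0. \<exists>r'. \<forall>b x. smooth_within H S b \<and> close \<delta> r' b \<and> x \<in> K \<longrightarrow> good b x"
  proof (rule ccontr)
    assume contra: "\<not> ?thesis"
    have "\<exists>b x. smooth_within H S b \<and> close (inverse (real (Suc n))) n b \<and> x \<in> K \<and> \<not> good b x" for n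
    proof -
      have "inverse (real (Suc n)) > 0" by simp
      with contra show ?thesis by blast
    qed
    then obtain b x where bx: "\<And>n. smooth_within H S (b n) \<and> close (inverse (real (Suc n))) n (b n) \<and>
        x n \<in> K \<and> \<not> good (b n) (x n)"
      by metis
    have b: "\<And>n. smooth_within H S (b n)"
       "\<And>n y vs. y \<in> K \<Longrightarrow> set vs \<subseteq> Basis \<Longrightarrow> length vs \<le> n \<Longrightarrow>
          norm (partials H a vs y - partials H (b n) vs y) < inverse (real (Suc n))"
       "\<And>n. x n \<in> K" "\<And>n. \<not> good (b n) (x n)"
      using bx unfolding close_def by blast+
    have lim: "uniform_limit K (\<lambda>n. partials H (b n) vs) (partials H a vs) sequentially"
      if "set vs \<subseteq> Basis" for vs
    proof (rule uniform_limitI)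
      fix e :: real assume "e > 0"
      then obtain N where N: "inverse (real (Suc N)) < e" using reals_Archimedean by blast
      have "\<forall>y\<in>K. dist (partials H (b n) vs y) (partials H a vs y) < e"
        if "n \<ge> max N (length vs)" for n
      proof
        fix y assume "y \<in> K"
        have "inverse (real (Suc n)) \<le> inverse (real (Suc N))"
          using that by (intro le_imp_inverse_le) auto
        moreover have "norm (partials H a vs y - partials H (b n) vs y) < inverse (real (Suc n))"
          using b(2)[OF \<open>y \<in> K\<close> \<open>set vs \<subseteq> Basis\<close>, of n] that by simp
        ultimately show "dist (partials H (b n) vs y) (partials H a vs y) < e"
          using N unfolding dist_norm by (subst norm_minus_commute) linarith
      qed
      then show "\<forall>\<^sub>F n in sequentially. \<forall>y\<in>K. dist (partials H (b n) vs y) (partials H a vs y) < e"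
        using eventually_sequentially by blast
    qed
    have cont: "continuous_on S g" if "smooth_within H S g" for g :: "'e \<Rightarrow> real"
      using smooth_within_continuous_on[OF that, of "[]"] by (simp add: partials_Nil)
    have open\<Omega>: "open \<Omega>" using \<theta> by (simp add: smooth_on_open_def)
    have "compact (a ` K)"
      using cont[OF a] K by (meson compact_continuous_image continuous_on_subset)
    then obtain e where e: "e > 0" "(\<Union>y\<in>a ` K. ball y e) \<subseteq> \<Omega>"
      using compact_subset_open_imp_ball_epsilon_subset[OF _ open\<Omega> aK] by blast
    have "\<forall>\<^sub>F n in sequentially. \<forall>x\<in>K. dist (b n x) (a x) < e"
      using uniform_limitD[OF lim[of "[]"] e(1)] by (simp add: partials_Nil)
    then obtain N where N: "\<And>n x. n \<ge> N \<Longrightarrow> x \<in> K \<Longrightarrow> dist (b n x) (a x) < e"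
      unfolding eventually_sequentially by blast
    have bK: "b (n + N) ` K \<subseteq> \<Omega>" for n
      using N[of "n + N"] e(2) by (force simp: dist_commute)
    \<comment> \<open>Only terms mapping \<open>K\<close> into \<open>\<Omega>\<close> can be composed with \<open>\<theta>\<close>, so the first \<open>N\<close> terms are dropped.\<close>
    define c where "c i = (case i of None \<Rightarrow> a | Some n \<Rightarrow> b (n + N))" for i
    define T where "T i = S \<inter> c i -` \<Omega>" for i
    have c: "smooth_within H S (c i)" for i
      using a b(1) by (auto simp: c_def split: option.splits)
    have SH: "openin (top_of_set H) S" using a smooth_within_openin by blast
    have T: "openin (top_of_set H) (T i)" for i
      unfolding T_def using continuous_openin_preimage_gen[OF cont[OF c] open\<Omega>] openin_trans SH by blast
    have KT: "K \<subseteq> T i" for i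
    proof (cases i)
      case None
      then show ?thesis using K(2) aK by (auto simp: T_def c_def)
    next
      case (Some n)
      then show ?thesis using K(2) bK[of n] by (auto simp: T_def c_def)
    qed
    have "smooth_within H (T i) (c i)" for i
      using smooth_within_subset[OF c T] by (auto simp: T_def)
    moreover have "uniform_limit K (\<lambda>n. partials H (c (Some n)) vs) (partials H (c None) vs) sequentially"
      if "set vs \<subseteq> Basis" for vs
      unfolding c_def using filterlim_compose[OF lim[OF that] filterlim_add_const_nat_at_top] by simp
    ultimately have "smooth_convergent H T K c" by (simp add: smooth_convergent_def)
    moreover have "c i ` T i \<subseteq> \<Omega>" for i by (auto simp: T_def)
    ultimately have "generated_family H T K (\<lambda>i x. \<theta> (c i x))"
      using generated_family.comp[where b = c] \<theta> by blast
    then have conv: "smooth_convergent H T K (\<lambda>i x. \<theta> (c i x))"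
      by (rule smooth_convergent_generated[OF H K(1) T KT])
    have fin: "finite {vs. set vs \<subseteq> (Basis :: 'e set) \<and> length vs \<le> r}"
      by (rule finite_lists_length_le) simp
    have "\<forall>\<^sub>F n in sequentially. \<forall>vs\<in>{vs. set vs \<subseteq> (Basis :: 'e set) \<and> length vs \<le> r}.
       \<forall>x\<in>K. dist (partials H (\<lambda>x. \<theta> (c (Some n) x)) vs x) (partials H (\<lambda>x. \<theta> (c None x)) vs x) < \<epsilon>"
    proof (rule eventually_ball_finite[OF fin], rule ballI)
      fix vs :: "'e list" assume "vs \<in> {vs. set vs \<subseteq> Basis \<and> length vs \<le> r}"
      then have "uniform_limit K (\<lambda>n. partials H (\<lambda>x. \<theta> (c (Some n) x)) vs)
          (partials H (\<lambda>x. \<theta> (c None x)) vs) sequentially"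
        using conv unfolding smooth_convergent_def by blast
      from uniform_limitD[OF this \<open>\<epsilon> > 0\<close>]
      show "\<forall>\<^sub>F n in sequentially. \<forall>x\<in>K.
          dist (partials H (\<lambda>x. \<theta> (c (Some n) x)) vs x) (partials H (\<lambda>x. \<theta> (c None x)) vs x) < \<epsilon>" .
    qed
    then obtain n where n: "\<And>vs x. set vs \<subseteq> (Basis :: 'e set) \<Longrightarrow> length vs \<le> r \<Longrightarrow> x \<in> K \<Longrightarrow>
       dist (partials H (\<lambda>x. \<theta> (c (Some n) x)) vs x) (partials H (\<lambda>x. \<theta> (c None x)) vs x) < \<epsilon>"
      unfolding eventually_sequentially by blast
    have "b (n + N) (x (n + N)) \<in> \<Omega>" using bK b(3) by blast
    moreover have "norm (partials H (\<theta> \<circ> a) vs (x (n + N)) - partials H (\<theta> \<circ> b (n + N)) vs (x (n + N))) < \<epsilon>"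
      if "set vs \<subseteq> Basis" "length vs \<le> r" for vs
      using n[OF that b(3)[of "n + N"]] by (simp add: c_def comp_def dist_norm norm_minus_commute)
    ultimately show False using b(4)[of "n + N"] unfolding good_def by blast
  qed
  then obtain \<delta> r' where "\<delta> > 0"
    and *: "\<And>b x. smooth_within H S b \<Longrightarrow> close \<delta> r' b \<Longrightarrow> x \<in> K \<Longrightarrow> good b x" by blast
  show ?thesis
  proof (rule that[OF \<open>\<delta> > 0\<close>])
    fix b x assume "smooth_within H S b" "x \<in> K"
      "\<And>x vs. x \<in> K \<Longrightarrow> set vs \<subseteq> Basis \<Longrightarrow> length vs \<le> r' \<Longrightarrow>
          norm (partials H a vs x - partials H b vs x) < \<delta>"
    then have "good b x" by (intro *) (auto simp: close_def)
    then show "b x \<in> \<Omega> \<and> (\<forall>vs. set vs \<subseteq> Basis \<and> length vs \<le> r \<longrightarrow>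
         norm (partials H (\<theta> \<circ> a) vs x - partials H (\<theta> \<circ> b) vs x) < \<epsilon>)"
      by (simp add: good_def)
  qed
qed


lemma smooth_on_subset:
  assumes "smooth_on S g" "T \<subseteq> S"
  shows "smooth_on T g"
  unfolding smooth_on_def
proof
  fix x assume "x \<in> T"
  then obtain W G where "x \<in> W" "smooth_on_open W G" "\<forall>y\<in>W \<inter> S. G y = g y"
    using assms unfolding smooth_on_def by (meson subsetD)
  then show "\<exists>W G. x \<in> W \<and> smooth_on_open W G \<and> (\<forall>y\<in>W \<inter> T. G y = g y)"
    using assms(2) by (intro exI[of _ W] exI[of _ G]) auto
qed

lemma smooth_on_cong:
  assumes "smooth_on S g" "\<And>x. x \<in> S \<Longrightarrow> g x = h x"
  shows "smooth_on S h"
  unfolding smooth_on_def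
proof
  fix x assume "x \<in> S"
  then obtain W G where "x \<in> W" "smooth_on_open W G" "\<forall>y\<in>W \<inter> S. G y = g y"
    using assms(1) unfolding smooth_on_def by meson
  then show "\<exists>W G. x \<in> W \<and> smooth_on_open W G \<and> (\<forall>y\<in>W \<inter> S. G y = h y)"
    using assms(2) by (intro exI[of _ W] exI[of _ G]) auto
qed

lemma partials_const:
  assumes "axis_thick H" "x \<in> H"
  shows "partials H (\<lambda>_. c) (v # vs) x = 0"
  using assms(2)
proof (induction vs arbitrary: v x)
  case Nil
  then show ?case
    by (simp add: partials_Nil frechet_derivative_within_eq[OF assms(1) Nil has_derivative_const])
next
  case (Cons w vs)
  have "(partials H (\<lambda>_. c) (w # vs) has_derivative (\<lambda>_. 0)) (at x within H)"
    by (rule has_derivative_transform[OF Cons.prems Cons.IH has_derivative_const])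
  from frechet_derivative_within_eq[OF assms(1) Cons.prems this] show ?case by simp
qed

section \<open>Charts of the line and of the circle\<close>

text \<open>
  Translations by integers are the transition functions between the angle charts of the circle.
\<close>

lemma smooth_within_translation:
  fixes c :: real
  shows "smooth_within UNIV UNIV (\<lambda>s. s + c)"
  unfolding smooth_within_def
proof (intro conjI allI impI ballI)
  fix vs :: "real list" and x :: real
  show "partials UNIV (\<lambda>s. s + c) vs differentiable (at x)"
  proof (cases vs rule: rev_cases)
    case Nil
    then show ?thesis by (simp add: partials_Nil)
  next
    case (snoc us v)
    have "partials UNIV (\<lambda>s. s + c) [v] y = v" for y
    proof (rule partials_single_eq[OF axis_thick_UNIV, where D = "\<lambda>v. v"])
      show "((\<lambda>s. s + c) has_derivative (\<lambda>v. v)) (at y)"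
        using has_derivative_add[OF has_derivative_ident has_derivative_const] by simp
    qed simp
    then have "partials UNIV (\<lambda>s. s + c) [v] = (\<lambda>_. v)" by blast
    then have eq: "partials UNIV (\<lambda>s. s + c) vs = partials UNIV (\<lambda>_. v) us"
      unfolding snoc partials_append by simp
    show ?thesis
    proof (cases us)
      case Nil
      then show ?thesis unfolding eq by (simp add: partials_Nil)
    next
      case (Cons w ws)
      have "partials UNIV (\<lambda>_::real. v) us = (\<lambda>_. 0)"
        unfolding Cons using partials_const[OF axis_thick_UNIV] by blast
      then show ?thesis unfolding eq by simp
    qed
  qed
qed simp

lemma smooth_on_translation: "smooth_on S (\<lambda>s::real. s + c)"
  using smooth_within_translation[of c] unfolding smooth_within_UNIV smooth_on_def by blast

lemma real_line_chart_id: "(UNIV, \<lambda>x. x) \<in> mfd_charts real_line"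
proof -
  have "inv_into UNIV (\<lambda>x::real. x) = (\<lambda>x. x)"
    by (rule ext) (simp add: inv_into_f_f[of "\<lambda>x::real. x" UNIV, simplified])
  moreover have "smooth_on UNIV (\<lambda>x::real. x)"
    using smooth_on_translation[of UNIV 0] by simp
  ultimately show ?thesis
    using homeomorphic_map_id[of euclideanreal euclideanreal]
    by (simp add: real_line_def generated_atlas_def is_chart_def compatible_def comp_def id_def)
qed

lemma real_line_chart_smooth:
  assumes "(V, \<psi>) \<in> mfd_charts real_line"
  shows "smooth_on_open V \<psi>"
proof -
  have *: "open V" "smooth_on V (\<psi> \<circ> inv_into UNIV (\<lambda>x::real. x))"
    using assms by (auto simp: real_line_def generated_atlas_def is_chart_def compatible_def)
  moreover have "inv_into UNIV (\<lambda>x::real. x) = (\<lambda>x. x)"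
    by (rule ext) (simp add: inv_into_f_f[of "\<lambda>x::real. x" UNIV, simplified])
  ultimately show ?thesis using smooth_on_open_iff[OF *(1), of \<psi>] by (simp add: comp_def)
qed

abbreviation circle_arc :: "real \<Rightarrow> complex set" where
  "circle_arc a \<equiv> circle_cover ` {a<..<a+1}"

abbreviation arc_angle :: "real \<Rightarrow> complex \<Rightarrow> real" where
  "arc_angle a \<equiv> inv_into {a<..<a+1} circle_cover"

lemma circle_cover_eq_iff: "circle_cover s = circle_cover t \<longleftrightarrow> s - t \<in> \<int>"
proof -
  have "circle_cover s = circle_cover t \<longleftrightarrow>
      (\<exists>n::int. 2 * complex_of_real pi * \<i> * complex_of_real s =
         2 * complex_of_real pi * \<i> * complex_of_real t + of_int (2 * n) * complex_of_real pi * \<i>)"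
    by (simp add: circle_cover_def exp_eq)
  also have "\<dots> \<longleftrightarrow> (\<exists>n::int. s - t = of_int n)"
  proof (rule ex_cong1)
    fix n :: int
    let ?c = "2 * complex_of_real pi * \<i>"
    have "?c * complex_of_real t + of_int (2 * n) * complex_of_real pi * \<i>
        = ?c * (complex_of_real t + of_int n)"
      by (simp add: algebra_simps)
    then have "?c * complex_of_real s =
         ?c * complex_of_real t + of_int (2 * n) * complex_of_real pi * \<i>
       \<longleftrightarrow> complex_of_real s = complex_of_real t + of_int n"
      by (simp only: mult_cancel_left) simp
    also have "\<dots> \<longleftrightarrow> complex_of_real (s - t) = complex_of_real (of_int n)" by (auto simp: algebra_simps)
    also have "\<dots> \<longleftrightarrow> s - t = of_int n" by (simp only: of_real_eq_iff)
    finally show "2 * complex_of_real pi * \<i> * complex_of_real s =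
         2 * complex_of_real pi * \<i> * complex_of_real t + of_int (2 * n) * complex_of_real pi * \<i>
       \<longleftrightarrow> s - t = of_int n" .
  qed
  finally show ?thesis by (auto simp: Ints_def)
qed

lemma norm_circle_cover [simp]: "norm (circle_cover s) = 1"
  by (simp add: circle_cover_def norm_exp_eq_Re)

lemma continuous_on_circle_cover: "continuous_on S circle_cover"
  unfolding circle_cover_def by (intro continuous_intros)

lemma inj_on_circle_cover: "inj_on circle_cover {a<..<a+1}"
proof (rule inj_onI)
  fix s t assume st: "s \<in> {a<..<a+1}" "t \<in> {a<..<a+1}" "circle_cover s = circle_cover t"
  then obtain n :: int where n: "s - t = of_int n" by (auto simp: circle_cover_eq_iff Ints_def)
  with st have "\<bar>real_of_int n\<bar> < 1" by auto
  then have "n = 0" by linarith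
  then show "s = t" using n by simp
qed

lemma arc_angle_circle_cover: "s \<in> {a<..<a+1} \<Longrightarrow> arc_angle a (circle_cover s) = s"
  by (rule inv_into_f_f[OF inj_on_circle_cover])

lemma circle_cover_arc_angle: "z \<in> circle_arc a \<Longrightarrow> circle_cover (arc_angle a z) = z"
  by (rule f_inv_into_f)

lemma circle_cover_add_int: "circle_cover (s + of_int k) = circle_cover s"
  by (simp add: circle_cover_eq_iff)

text \<open>
  Every point of the circle has an angle in any prescribed half-open interval of length \<open>1\<close>: shift an
  arbitrary angle by a suitable integer.
\<close>

lemma circle_cover_surj:
  assumes "z \<in> sphere 0 1"
  obtains s where "a \<le> s" "s < a + 1" "circle_cover s = z"
proof -
  have "z = exp (\<i> * of_real (Arg z))"
    using assms Arg_eq[of z] by (cases "z = 0") auto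
  also have "\<dots> = circle_cover (Arg z / (2 * pi))"
    by (simp add: circle_cover_def mult_ac)
  finally have z: "circle_cover (Arg z / (2 * pi)) = z" by simp
  let ?s = "Arg z / (2 * pi)"
  let ?k = "\<lfloor>?s - a\<rfloor>"
  have "circle_cover (?s + of_int (- ?k)) = z" using z circle_cover_add_int by metis
  moreover have "a \<le> ?s + of_int (- ?k)" "?s + of_int (- ?k) < a + 1" by (simp_all, linarith+)
  ultimately show ?thesis using that by blast
qed

lemma arc_eq: "circle_arc a = sphere 0 1 - {circle_cover a}"
proof (intro equalityI subsetI)
  fix z assume "z \<in> circle_arc a"
  then obtain s where s: "s \<in> {a<..<a+1}" "z = circle_cover s" by blast
  have "circle_cover s \<noteq> circle_cover a"
  proof
    assume "circle_cover s = circle_cover a"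
    then obtain n :: int where "s - a = of_int n" by (auto simp: circle_cover_eq_iff Ints_def)
    with s have "0 < real_of_int n" "real_of_int n < 1" by auto
    then show False by simp
  qed
  then show "z \<in> sphere 0 1 - {circle_cover a}" using s by auto
next
  fix z assume z: "z \<in> sphere 0 1 - {circle_cover a}"
  then obtain s where "a \<le> s" "s < a + 1" "circle_cover s = z" using circle_cover_surj[of z a] by blast
  then show "z \<in> circle_arc a" using z by (cases "s = a") auto
qed

lemma openin_arc: "openin (top_of_set (sphere 0 1)) (circle_arc a)"
proof -
  have "circle_arc a = sphere 0 1 \<inter> (- {circle_cover a})" by (auto simp: arc_eq)
  then show ?thesis by (metis open_Compl closed_singleton openin_open_Int)
qed

text \<open>
  Rotating the middle of the arc to \<open>1\<close> keeps the arc away from the branch cut of the logarithm, so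
  the angle is the imaginary part of a continuous logarithm.
\<close>

lemma continuous_on_arc_angle: "continuous_on (circle_arc a) (arc_angle a)"
proof (rule continuous_on_eq)
  let ?g = "\<lambda>z. a + 1/2 + Im (Ln (z / circle_cover (a + 1/2))) / (2 * pi)"
  have quot: "circle_cover s / circle_cover (a + 1/2) = exp (\<i> * of_real (2 * pi * (s - a - 1/2)))" for s
    unfolding circle_cover_def exp_diff[symmetric] by (rule arg_cong[of _ _ exp]) (simp add: algebra_simps)
  have range: "- pi < 2 * pi * (s - a - 1/2)" "2 * pi * (s - a - 1/2) < pi" if "s \<in> {a<..<a+1}" for s
  proof -
    have "2 * pi * (- 1/2) < 2 * pi * (s - a - 1/2)" "2 * pi * (s - a - 1/2) < 2 * pi * (1/2)"
      using that by (intro mult_strict_left_mono; simp)+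
    then show "- pi < 2 * pi * (s - a - 1/2)" "2 * pi * (s - a - 1/2) < pi" by simp_all
  qed
  have ln: "Ln (circle_cover s / circle_cover (a + 1/2)) = \<i> * of_real (2 * pi * (s - a - 1/2))"
    if "s \<in> {a<..<a+1}" for s
    unfolding quot using range[OF that] by (intro Ln_exp) simp_all
  show "?g z = arc_angle a z" if "z \<in> circle_arc a" for z
  proof -
    obtain s where s: "s \<in> {a<..<a+1}" "z = circle_cover s" using \<open>z \<in> circle_arc a\<close> by blast
    show ?thesis unfolding s(2) ln[OF s(1)] arc_angle_circle_cover[OF s(1)] by simp
  qed
  have "z / circle_cover (a + 1/2) \<notin> \<real>\<^sub>\<le>\<^sub>0" if "z \<in> circle_arc a" for z
  proof
    assume neg: "z / circle_cover (a + 1/2) \<in> \<real>\<^sub>\<le>\<^sub>0"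
    obtain s where s: "s \<in> {a<..<a+1}" "z = circle_cover s" using \<open>z \<in> circle_arc a\<close> by blast
    let ?w = "z / circle_cover (a + 1/2)"
    have w0: "?w \<noteq> 0" using s by (simp add: quot)
    from neg obtain r where "?w = of_real r" "r \<le> 0" by (rule nonpos_Reals_cases)
    with w0 have "Im (Ln ?w) = pi" using Arg_of_real[of r] by (simp add: Arg_def)
    then show False using range(2)[OF s(1)] unfolding s(2) ln[OF s(1)] by simp
  qed
  moreover have "circle_cover (a + 1/2) \<noteq> 0" by (simp add: circle_cover_def)
  ultimately show "continuous_on (circle_arc a) ?g" by (intro continuous_intros) auto
qed

lemma arc_angle_image: "arc_angle a ` (V \<inter> circle_arc a) = {a<..<a+1} \<inter> circle_cover -` V"
proof (intro equalityI subsetI)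
  fix s assume "s \<in> {a<..<a+1} \<inter> circle_cover -` V"
  then show "s \<in> arc_angle a ` (V \<inter> circle_arc a)"
    by (intro image_eqI[of _ _ "circle_cover s"]) (auto simp: arc_angle_circle_cover)
qed (auto simp: arc_angle_circle_cover)

lemma is_chart_arc: "is_chart (top_of_set (sphere 0 1)) UNIV (circle_arc a, arc_angle a)"
proof -
  have im: "arc_angle a ` circle_arc a = {a<..<a+1}"
    using arc_angle_image[of a UNIV] by simp
  have "homeomorphic_maps (top_of_set (circle_arc a)) (top_of_set {a<..<a+1}) (arc_angle a) circle_cover"
    unfolding homeomorphic_maps_def
    using continuous_on_arc_angle[of a] continuous_on_circle_cover[of "{a<..<a+1}"]
    by (auto simp: circle_cover_arc_angle arc_angle_circle_cover)
  moreover have "subtopology (top_of_set (sphere 0 1)) (circle_arc a) = top_of_set (circle_arc a)"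
    by (simp add: subtopology_subtopology arc_eq Int_absorb1)
  ultimately show ?thesis
    unfolding is_chart_def using openin_arc im by (auto simp: homeomorphic_map_maps)
qed

lemma inv_into_arc_angle: "s \<in> {a<..<a+1} \<Longrightarrow> inv_into (circle_arc a) (arc_angle a) s = circle_cover s"
proof -
  assume s: "s \<in> {a<..<a+1}"
  have "inj_on (arc_angle a) (circle_arc a)"
    by (metis circle_cover_arc_angle inj_onI)
  then show ?thesis
    using inv_into_f_f[of "arc_angle a" "circle_arc a" "circle_cover s"] s
    unfolding arc_angle_circle_cover[OF s] by blast
qed

text \<open>
  Both angles of a point lift the same point of the circle, hence locally differ by a constant
  integer.
\<close>

lemma smooth_on_arc_transition:
  "smooth_on (arc_angle a ` (circle_arc b \<inter> circle_arc a)) (arc_angle b \<circ> inv_into (circle_arc a) (arc_angle a))"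
proof (rule smooth_on_locally)
  fix s assume "s \<in> arc_angle a ` (circle_arc b \<inter> circle_arc a)"
  then have s: "s \<in> {a<..<a+1}" "circle_cover s \<in> circle_arc b" by (simp_all add: arc_angle_image)
  then obtain t where t: "t \<in> {b<..<b+1}" "circle_cover t = circle_cover s" by (metis imageE)
  then obtain k :: int where k: "t = s + of_int k"
    by (auto simp: circle_cover_eq_iff Ints_def algebra_simps)
  let ?W = "{b - of_int k<..<b - of_int k + 1}"
  have "s' + of_int k = (arc_angle b \<circ> inv_into (circle_arc a) (arc_angle a)) s'"
    if "s' \<in> ?W \<inter> arc_angle a ` (circle_arc b \<inter> circle_arc a)" for s'
  proof -
    have s': "s' \<in> {a<..<a+1}" "s' + of_int k \<in> {b<..<b+1}"
      using that by (auto simp: arc_angle_image)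
    show ?thesis
      using arc_angle_circle_cover[OF s'(2)] inv_into_arc_angle[OF s'(1)] circle_cover_add_int by simp
  qed
  moreover have "s \<in> ?W" using t k by auto
  ultimately show "\<exists>W h. open W \<and> s \<in> W \<and> smooth_on (W \<inter> arc_angle a ` (circle_arc b \<inter> circle_arc a)) h \<and>
      (\<forall>y\<in>W \<inter> arc_angle a ` (circle_arc b \<inter> circle_arc a). h y = (arc_angle b \<circ> inv_into (circle_arc a) (arc_angle a)) y)"
    using smooth_on_translation by (intro exI[of _ ?W] exI[of _ "\<lambda>s. s + of_int k"]) auto
qed

lemma circle_chart_arc: "(circle_arc a, arc_angle a) \<in> mfd_charts circle"
proof -
  have "compatible (circle_arc a, arc_angle a) (circle_arc b, arc_angle b)" for b
    using smooth_on_arc_transition[of a b] smooth_on_arc_transition[of b a]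
    by (simp add: compatible_def Int_commute)
  then show ?thesis
    using is_chart_arc by (auto simp: circle_def generated_atlas_def)
qed

text \<open>
  Every chart of the circle is compatible with the angle charts, and the inverse of an angle chart is a
  restriction of the covering map. This reduces all questions about charts of the circle to smooth
  functions on open subsets of the line.
\<close>

lemma circle_chart_smooth:
  assumes "(V, \<psi>) \<in> mfd_charts circle"
  shows "smooth_on_open (circle_cover -` V) (\<psi> \<circ> circle_cover)"
proof -
  have V: "openin (top_of_set (sphere 0 1)) V"
    and comp: "\<And>a. compatible (V, \<psi>) (circle_arc a, arc_angle a)"
    using assms by (auto simp: circle_def generated_atlas_def is_chart_def)
  obtain T where "open T" "V = sphere 0 1 \<inter> T" using V openin_open by blast
  then have "circle_cover -` V = circle_cover -` T" by auto
  then have op: "open (circle_cover -` V)"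
    using continuous_on_circle_cover[of UNIV] \<open>open T\<close> by (metis continuous_on_open_vimage open_UNIV Int_UNIV_right)
  have "smooth_on (circle_cover -` V) (\<psi> \<circ> circle_cover)"
  proof (rule smooth_on_locally)
    fix s assume "s \<in> circle_cover -` V"
    define a where "a = s - 1/2"
    then have s: "s \<in> {a<..<a+1}" by simp
    have "smooth_on (arc_angle a ` (V \<inter> circle_arc a)) (\<psi> \<circ> inv_into (circle_arc a) (arc_angle a))"
      using comp[of a] by (simp add: compatible_def)
    then have "smooth_on ({a<..<a+1} \<inter> circle_cover -` V) (\<psi> \<circ> inv_into (circle_arc a) (arc_angle a))"
      by (simp only: arc_angle_image)
    then show "\<exists>W h. open W \<and> s \<in> W \<and> smooth_on (W \<inter> circle_cover -` V) h \<and>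
        (\<forall>y\<in>W \<inter> circle_cover -` V. h y = (\<psi> \<circ> circle_cover) y)"
      using s inv_into_arc_angle[of _ a]
      by (intro exI[of _ "{a<..<a+1}"] exI[of _ "\<psi> \<circ> inv_into (circle_arc a) (arc_angle a)"]) simp
  qed
  then show ?thesis using smooth_on_open_iff[OF op] by blast
qed

section \<open>Smooth maps into the line and into the circle\<close>

lemma smooth_manifold_chart:
  assumes "smooth_manifold M" "(U, \<phi>) \<in> mfd_charts M"
  shows "is_chart (mfd_top M) (mfd_model M) (U, \<phi>)"
    and "(V, \<psi>) \<in> mfd_charts M \<Longrightarrow> compatible (U, \<phi>) (V, \<psi>)"
  using assms unfolding smooth_manifold_def generated_atlas_def by blast+

lemma chart_properties:
  assumes "smooth_manifold M" "(U, \<phi>) \<in> mfd_charts M"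
  shows chart_openin: "openin (mfd_top M) U"
    and chart_subset: "U \<subseteq> points M"
    and chart_inj: "inj_on \<phi> U"
    and chart_inv_into: "y \<in> \<phi> ` U \<Longrightarrow> inv_into U \<phi> y \<in> U"
    and chart_inv_into_eq: "x \<in> U \<Longrightarrow> inv_into U \<phi> (\<phi> x) = x"
    and chart_open_image: "openin (mfd_top M) W \<Longrightarrow> openin (top_of_set (mfd_model M)) (\<phi> ` (U \<inter> W))"
    and chart_compact_image: "compactin (mfd_top M) K \<Longrightarrow> K \<subseteq> U \<Longrightarrow> compact (\<phi> ` K)"
proof -
  have c: "openin (mfd_top M) U" "openin (top_of_set (mfd_model M)) (\<phi> ` U)"
     "homeomorphic_map (subtopology (mfd_top M) U) (top_of_set (\<phi> ` U)) \<phi>"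
    using smooth_manifold_chart(1)[OF assms] by (auto simp: is_chart_def)
  show "openin (mfd_top M) U" by fact
  show U: "U \<subseteq> points M" using c(1) openin_subset by blast
  then have top: "topspace (subtopology (mfd_top M) U) = U" by auto
  show inj: "inj_on \<phi> U"
    using homeomorphic_imp_injective_map[OF c(3)] top by simp
  show "y \<in> \<phi> ` U \<Longrightarrow> inv_into U \<phi> y \<in> U" by (rule inv_into_into)
  show "x \<in> U \<Longrightarrow> inv_into U \<phi> (\<phi> x) = x" by (rule inv_into_f_f[OF inj])
  show "openin (top_of_set (mfd_model M)) (\<phi> ` (U \<inter> W))" if "openin (mfd_top M) W"
  proof -
    have "openin (subtopology (mfd_top M) U) (U \<inter> W)"
      using that by (simp add: openin_subtopology_Int2)
    then have "openin (top_of_set (\<phi> ` U)) (\<phi> ` (U \<inter> W))"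
      using homeomorphic_imp_open_map[OF c(3)] by (simp add: open_map_def)
    then show ?thesis using c(2) openin_trans by blast
  qed
  show "compact (\<phi> ` K)" if "compactin (mfd_top M) K" "K \<subseteq> U"
  proof -
    have "compactin (subtopology (mfd_top M) U) K" using that by (simp add: compactin_subtopology)
    then have "compactin (top_of_set (\<phi> ` U)) (\<phi> ` K)"
      using image_compactin homeomorphic_imp_continuous_map[OF c(3)] by blast
    then show ?thesis by (simp add: compactin_subtopology)
  qed
qed

lemma smooth_mapsD:
  assumes "w \<in> smooth_maps M N"
  shows "w \<in> extensional (points M)" "continuous_map (mfd_top M) (mfd_top N) w"
    "(U, \<phi>) \<in> mfd_charts M \<Longrightarrow> (V, \<psi>) \<in> mfd_charts N \<Longrightarrow>
      smooth_on (\<phi> ` (U \<inter> w -` V)) (in_charts (U, \<phi>) (V, \<psi>) w)"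
  using assms unfolding smooth_maps_def by blast+

lemma openin_chart_preimage:
  assumes M: "smooth_manifold M" "(U, \<phi>) \<in> mfd_charts M"
    and "continuous_map (mfd_top M) Y w" "openin Y V"
  shows "openin (top_of_set (mfd_model M)) (\<phi> ` (U \<inter> w -` V))"
proof -
  have "openin (mfd_top M) {x \<in> points M. w x \<in> V}"
    using assms(3,4) openin_continuous_map_preimage by blast
  moreover have "U \<inter> w -` V = U \<inter> {x \<in> points M. w x \<in> V}" using chart_subset[OF M] by auto
  ultimately show ?thesis using chart_open_image[OF M] by simp
qed

text \<open>
  The identity is a chart of the line and every other chart is smooth with respect to it, so it
  suffices to test smoothness in this one chart.
\<close>

lemma smooth_map_real_line_iff:
  assumes M: "smooth_manifold M"
    and u: "u \<in> extensional (points M)" "continuous_map (mfd_top M) euclideanreal u"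
  shows "u \<in> smooth_maps M real_line \<longleftrightarrow>
    (\<forall>(U, \<phi>)\<in>mfd_charts M. smooth_on (\<phi> ` U) (u \<circ> inv_into U \<phi>))"
proof
  assume "u \<in> smooth_maps M real_line"
  then have "smooth_on (\<phi> ` U) (u \<circ> inv_into U \<phi>)" if "(U, \<phi>) \<in> mfd_charts M" for U \<phi>
    using smooth_mapsD(3)[OF _ that real_line_chart_id, of u] by (simp add: in_charts_def comp_def)
  then show "\<forall>(U, \<phi>)\<in>mfd_charts M. smooth_on (\<phi> ` U) (u \<circ> inv_into U \<phi>)" by blast
next
  assume sm: "\<forall>(U, \<phi>)\<in>mfd_charts M. smooth_on (\<phi> ` U) (u \<circ> inv_into U \<phi>)"
  have "smooth_on (\<phi> ` (U \<inter> u -` V)) (in_charts (U, \<phi>) (V, \<psi>) u)"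
    if c: "(U, \<phi>) \<in> mfd_charts M" and d: "(V, \<psi>) \<in> mfd_charts real_line" for U \<phi> V \<psi>
  proof -
    have "smooth_on (\<phi> ` (U \<inter> u -` V)) (u \<circ> inv_into U \<phi>)"
      using sm c by (blast intro: smooth_on_subset)
    moreover have "(u \<circ> inv_into U \<phi>) ` (\<phi> ` (U \<inter> u -` V)) \<subseteq> V"
      using chart_inv_into_eq[OF M c] by auto
    ultimately have "smooth_on (\<phi> ` (U \<inter> u -` V)) (\<psi> \<circ> (u \<circ> inv_into U \<phi>))"
      using smooth_on_compose[OF _ real_line_chart_smooth[OF d]] by blast
    then show ?thesis by (simp add: in_charts_def comp_assoc)
  qed
  then show "u \<in> smooth_maps M real_line"
    using u by (auto simp: smooth_maps_def real_line_def)
qed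

text \<open>
  The covering map is a local diffeomorphism: composing with it preserves smoothness, and where \<open>u\<close>
  takes values in an interval of length \<open>1\<close> it is the angle of its composite.
\<close>

lemma smooth_map_circle_iff:
  assumes M: "smooth_manifold M"
    and u: "u \<in> extensional (points M)" "continuous_map (mfd_top M) euclideanreal u"
  shows "restrict (circle_cover \<circ> u) (points M) \<in> smooth_maps M circle \<longleftrightarrow>
    u \<in> smooth_maps M real_line"
proof -
  define w where "w = restrict (circle_cover \<circ> u) (points M)"
  have w: "w x = circle_cover (u x)" if "x \<in> U" "(U, \<phi>) \<in> mfd_charts M" for x U \<phi>
    using chart_subset[OF M that(2)] that(1) by (auto simp: w_def)
  have ext: "w \<in> extensional (points M)" by (simp add: w_def)
  have "continuous_map (mfd_top M) (top_of_set (sphere 0 1)) (circle_cover \<circ> u)"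
    using continuous_on_circle_cover[of UNIV]
    by (intro continuous_map_compose[OF u(2)]) (auto simp: continuous_map_in_subtopology)
  then have cont: "continuous_map (mfd_top M) (mfd_top circle) w"
    unfolding circle_def w_def by (auto intro: continuous_map_eq)
  have "w \<in> smooth_maps M circle \<longleftrightarrow> u \<in> smooth_maps M real_line"
  proof
    assume "u \<in> smooth_maps M real_line"
    then have sm: "\<And>U \<phi>. (U, \<phi>) \<in> mfd_charts M \<Longrightarrow> smooth_on (\<phi> ` U) (u \<circ> inv_into U \<phi>)"
      using smooth_map_real_line_iff[OF M u] by blast
    have "smooth_on (\<phi> ` (U \<inter> w -` V)) (in_charts (U, \<phi>) (V, \<psi>) w)"
      if c: "(U, \<phi>) \<in> mfd_charts M" and d: "(V, \<psi>) \<in> mfd_charts circle" for U \<phi> V \<psi>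
    proof -
      have "smooth_on (\<phi> ` (U \<inter> w -` V)) (u \<circ> inv_into U \<phi>)"
        using sm[OF c] by (blast intro: smooth_on_subset)
      moreover have "(u \<circ> inv_into U \<phi>) ` (\<phi> ` (U \<inter> w -` V)) \<subseteq> circle_cover -` V"
        using chart_inv_into_eq[OF M c] w[OF _ c] by auto
      ultimately have "smooth_on (\<phi> ` (U \<inter> w -` V)) ((\<psi> \<circ> circle_cover) \<circ> (u \<circ> inv_into U \<phi>))"
        using smooth_on_compose[OF _ circle_chart_smooth[OF d]] by blast
      then show ?thesis
      proof (rule smooth_on_cong)
        fix y assume "y \<in> \<phi> ` (U \<inter> w -` V)"
        then obtain x where "x \<in> U" "y = \<phi> x" by blast
        then show "((\<psi> \<circ> circle_cover) \<circ> (u \<circ> inv_into U \<phi>)) y = in_charts (U, \<phi>) (V, \<psi>) w y"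
          by (simp add: in_charts_def chart_inv_into_eq[OF M c] w[OF _ c])
      qed
    qed
    then show "w \<in> smooth_maps M circle" using cont ext unfolding smooth_maps_def by blast
  next
    assume sm: "w \<in> smooth_maps M circle"
    have "smooth_on (\<phi> ` U) (u \<circ> inv_into U \<phi>)" if c: "(U, \<phi>) \<in> mfd_charts M" for U \<phi>
    proof (rule smooth_on_locally)
      fix y assume "y \<in> \<phi> ` U"
      then obtain x where x: "x \<in> U" "y = \<phi> x" by blast
      \<comment> \<open>The arc is centred at the value of \<open>u\<close>, so that the angle agrees with \<open>u\<close> near \<open>x\<close>.\<close>
      define a where "a = u x - 1/2"
      then have a: "u x \<in> {a<..<a+1}" by simp
      have "openin (top_of_set (mfd_model M)) (\<phi> ` (U \<inter> u -` {a<..<a+1}))"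
        using openin_chart_preimage[OF M c u(2)] by simp
      then obtain W where W: "open W" "\<phi> ` (U \<inter> u -` {a<..<a+1}) = mfd_model M \<inter> W"
        by (auto simp: openin_open)
      have mod: "\<phi> ` U \<subseteq> mfd_model M"
        using openin_imp_subset[OF chart_open_image[OF M c openin_topspace]] chart_subset[OF M c]
        by (simp add: Int_absorb2)
      have WU: "W \<inter> \<phi> ` U \<subseteq> \<phi> ` (U \<inter> u -` {a<..<a+1})"
        unfolding W(2) using mod by blast
      have loc: "u x' \<in> {a<..<a+1}" if "x' \<in> U" "\<phi> x' \<in> W" for x'
      proof -
        have "\<phi> x' \<in> \<phi> ` (U \<inter> u -` {a<..<a+1})" using that WU by blast
        then obtain x'' where "x'' \<in> U" "u x'' \<in> {a<..<a+1}" "\<phi> x' = \<phi> x''" by blast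
        then show ?thesis using inj_onD[OF chart_inj[OF M c]] that(1) by metis
      qed
      have "smooth_on (\<phi> ` (U \<inter> w -` circle_arc a)) (in_charts (U, \<phi>) (circle_arc a, arc_angle a) w)"
        by (rule smooth_mapsD(3)[OF sm c circle_chart_arc])
      moreover have "W \<inter> \<phi> ` U \<subseteq> \<phi> ` (U \<inter> w -` circle_arc a)"
      proof
        fix y' assume "y' \<in> W \<inter> \<phi> ` U"
        then obtain x' where x': "x' \<in> U" "y' = \<phi> x'" "\<phi> x' \<in> W" by blast
        then have "w x' \<in> circle_arc a"
          unfolding w[OF x'(1) c] by (intro imageI loc)
        then show "y' \<in> \<phi> ` (U \<inter> w -` circle_arc a)" using x' by blast
      qed
      ultimately have "smooth_on (W \<inter> \<phi> ` U) (in_charts (U, \<phi>) (circle_arc a, arc_angle a) w)"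
        by (rule smooth_on_subset)
      moreover have "in_charts (U, \<phi>) (circle_arc a, arc_angle a) w y' = (u \<circ> inv_into U \<phi>) y'"
        if y': "y' \<in> W \<inter> \<phi> ` U" for y'
      proof -
        obtain x' where x': "x' \<in> U" "y' = \<phi> x'" using y' by blast
        then have "u x' \<in> {a<..<a+1}" using y' by (intro loc) auto
        from arc_angle_circle_cover[OF this] show ?thesis
          by (simp only: in_charts_def split comp_apply x' chart_inv_into_eq[OF M c] w[OF _ c])
      qed
      moreover have yW: "y \<in> W"
      proof -
        have "y \<in> \<phi> ` (U \<inter> u -` {a<..<a+1})" using x a by blast
        then show ?thesis unfolding W(2) by blast
      qed
      ultimately show "\<exists>W h. open W \<and> y \<in> W \<and> smooth_on (W \<inter> \<phi> ` U) h \<and>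
          (\<forall>z\<in>W \<inter> \<phi> ` U. h z = (u \<circ> inv_into U \<phi>) z)"
        using W(1) by (intro exI[of _ W] exI[of _ "in_charts (U, \<phi>) (circle_arc a, arc_angle a) w"]) simp
    qed
    then show "u \<in> smooth_maps M real_line"
      using smooth_map_real_line_iff[OF M u] by blast
  qed
  then show ?thesis by (simp only: w_def)
qed

lemma smooth_within_in_charts:
  assumes M: "smooth_manifold M" "axis_thick (mfd_model M)" and w: "w \<in> smooth_maps M N"
    and c: "(U, \<phi>) \<in> mfd_charts M" and d: "(V, \<psi>) \<in> mfd_charts N" "openin (mfd_top N) V"
  shows "smooth_within (mfd_model M) (\<phi> ` (U \<inter> w -` V)) (in_charts (U, \<phi>) (V, \<psi>) w)"
  by (intro smooth_on_imp_smooth_within M openin_chart_preimage[OF M(1) c _ d(2)] smooth_mapsD[OF w] c d)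

lemma smooth_within_real_line:
  assumes M: "smooth_manifold M" "axis_thick (mfd_model M)" and "u \<in> smooth_maps M real_line"
    and c: "(U, \<phi>) \<in> mfd_charts M"
  shows "smooth_within (mfd_model M) (\<phi> ` U) (u \<circ> inv_into U \<phi>)"
  using smooth_within_in_charts[OF M assms(3) c real_line_chart_id]
  by (simp add: in_charts_def comp_def real_line_def)


section \<open>The Whitney topology over a compact manifold\<close>

lemma whitney_nbhd_single:
  "g \<in> whitney_nbhd M N f {((U, \<phi>), K, (V, \<psi>), \<epsilon>)} r \<longleftrightarrow> g \<in> smooth_maps M N \<and> g ` K \<subseteq> V \<and>
     (\<forall>x\<in>\<phi> ` K. \<forall>vs. set vs \<subseteq> Basis \<and> length vs \<le> r \<longrightarrow>
        norm (partials (mfd_model M) (in_charts (U, \<phi>) (V, \<psi>) f) vs x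
            - partials (mfd_model M) (in_charts (U, \<phi>) (V, \<psi>) g) vs x) < \<epsilon>)"
  by (simp add: whitney_nbhd_def)

text \<open>
  A Whitney neighbourhood is an intersection of conditions, one for each tuple of the family. On a
  compact manifold finitely many of these suffice, so single tuples generate the topology.
\<close>

lemma whitney_nbhd_iff_single:
  fixes \<Phi> :: "('a, 'e::euclidean_space, 'b, 'f::euclidean_space) nbhd_datum set" and g :: "'a \<Rightarrow> 'b"
  shows "g \<in> whitney_nbhd M N f \<Phi> r \<longleftrightarrow>
     g \<in> smooth_maps M N \<and> (\<forall>d\<in>\<Phi>. g \<in> whitney_nbhd M N f {d} r)"
proof -
  have "g \<in> {g \<in> S. \<forall>d\<in>\<Phi>. P g d} \<longleftrightarrow> g \<in> S \<and> (\<forall>d\<in>\<Phi>. g \<in> {g \<in> S. \<forall>e\<in>{d}. P g e})"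
    for S and P :: "('a \<Rightarrow> 'b) \<Rightarrow> ('a, 'e, 'b, 'f) nbhd_datum \<Rightarrow> bool"
    by auto
  then show ?thesis unfolding whitney_nbhd_def by this
qed

lemma openin_whitney_nbhd_single:
  assumes "f \<in> smooth_maps M N" "(U, \<phi>) \<in> mfd_charts M" "(V, \<psi>) \<in> mfd_charts N"
    "compactin (mfd_top M) K" "K \<subseteq> U" "f ` K \<subseteq> V" "\<epsilon> > 0"
  shows "openin (whitney_topology M N) (whitney_nbhd M N f {((U, \<phi>), K, (V, \<psi>), \<epsilon>)} r)"
proof -
  let ?\<Phi> = "{((U, \<phi>), K, (V, \<psi>), \<epsilon>)}"
  have "finite {((U', \<phi>'), d). ((U', \<phi>'), d) \<in> ?\<Phi> \<and> U' \<inter> W \<noteq> {}}" for W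
    by (rule finite_subset[of _ ?\<Phi>]) auto
  then have "whitney_family M N f ?\<Phi>"
    using assms unfolding whitney_family_def by (auto intro: openin_topspace)
  then show ?thesis
    unfolding whitney_topology_def using assms(1) by (intro topology_generated_by_Basis) blast
qed

lemma whitney_nbhd_self:
  assumes "f \<in> smooth_maps M N" "f ` K \<subseteq> V" "\<epsilon> > 0"
  shows "f \<in> whitney_nbhd M N f {((U, \<phi>), K, (V, \<psi>), \<epsilon>)} r"
  using assms by (simp add: whitney_nbhd_single)

lemma topspace_whitney_topology: "topspace (whitney_topology M N) = smooth_maps M N"
proof (intro equalityI subsetI)
  fix f assume "f \<in> topspace (whitney_topology M N)"
  then show "f \<in> smooth_maps M N"
    unfolding whitney_topology_def topology_generated_by_topspace by (auto simp: whitney_nbhd_def)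
next
  fix f assume f: "f \<in> smooth_maps M N"
  have "whitney_family M N f {}"
    unfolding whitney_family_def by (auto intro!: exI[of _ "points M"] simp: case_prod_unfold)
  moreover have "f \<in> whitney_nbhd M N f {} 0" using f by (simp add: whitney_nbhd_def)
  ultimately show "f \<in> topspace (whitney_topology M N)"
    unfolding whitney_topology_def topology_generated_by_topspace using f by blast
qed

lemma compact_uniform_gap:
  fixes D :: "'x::topological_space \<Rightarrow> real"
  assumes "compact K" "continuous_on K D" "\<And>x. x \<in> K \<Longrightarrow> D x < \<epsilon>"
  shows "\<exists>\<eta>>0. \<forall>x\<in>K. D x + \<eta> \<le> \<epsilon>"
proof (cases "K = {}")
  case True
  then show ?thesis by (intro exI[of _ 1]) simp
next
  case False
  then obtain x where "x \<in> K" "\<forall>y\<in>K. D y \<le> D x"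
    using continuous_attains_sup[OF assms(1) _ assms(2)] by blast
  then show ?thesis using assms(3)[of x] by (intro exI[of _ "\<epsilon> - D x"]) simp
qed

text \<open>
  A subbasic set is a neighbourhood of each of its elements \<open>g\<close>, not only of its centre: the strict
  inequalities defining it leave a uniform gap on the compact set, because the finitely many partial
  derivatives involved are continuous there.
\<close>

lemma whitney_nbhd_refine:
  assumes M: "smooth_manifold M" "axis_thick (mfd_model M)"
    and c: "(U, \<phi>) \<in> mfd_charts M" and d: "(V, \<psi>) \<in> mfd_charts N" "openin (mfd_top N) V"
    and K: "compactin (mfd_top M) K" "K \<subseteq> U" and f: "f \<in> smooth_maps M N" "f ` K \<subseteq> V"
    and g: "g \<in> whitney_nbhd M N f {((U, \<phi>), K, (V, \<psi>), \<epsilon>)} r"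
  obtains \<eta> where "\<eta> > 0"
    "whitney_nbhd M N g {((U, \<phi>), K, (V, \<psi>), \<eta>)} r \<subseteq> whitney_nbhd M N f {((U, \<phi>), K, (V, \<psi>), \<epsilon>)} r"
proof -
  let ?H = "mfd_model M"
  let ?f = "in_charts (U, \<phi>) (V, \<psi>) f" and ?g = "in_charts (U, \<phi>) (V, \<psi>) g"
  let ?D = "\<lambda>vs x. norm (partials ?H ?f vs x - partials ?H ?g vs x)"
  define L where "L = {vs. set vs \<subseteq> (Basis :: 'b set) \<and> length vs \<le> r}"
  have L: "finite L" "[] \<in> L"
    unfolding L_def using finite_lists_length_le[of "Basis :: 'b set"] by auto
  note g_nbhd = g[unfolded whitney_nbhd_single]
  have g': "g \<in> smooth_maps M N" "g ` K \<subseteq> V" using g_nbhd by simp_all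
  have D: "?D vs x < \<epsilon>" if "vs \<in> L" "x \<in> \<phi> ` K" for vs x
    using g_nbhd that(1)[unfolded L_def mem_Collect_eq] that(2) by blast
  have cont: "continuous_on (\<phi> ` K) (partials ?H (in_charts (U, \<phi>) (V, \<psi>) h) vs)"
    if "h \<in> smooth_maps M N" "h ` K \<subseteq> V" "vs \<in> L" for h vs
  proof (rule continuous_on_subset)
    show "continuous_on (\<phi> ` (U \<inter> h -` V)) (partials ?H (in_charts (U, \<phi>) (V, \<psi>) h) vs)"
      using that(3) by (intro smooth_within_continuous_on[OF smooth_within_in_charts[OF M that(1) c d]])
        (simp add: L_def)
    show "\<phi> ` K \<subseteq> \<phi> ` (U \<inter> h -` V)" using that(2) K(2) by blast
  qed
  have "\<exists>\<eta>>0. \<forall>x\<in>\<phi> ` K. ?D vs x + \<eta> \<le> \<epsilon>" if "vs \<in> L" for vs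
  proof -
    have "continuous_on (\<phi> ` K) (?D vs)"
      by (intro continuous_intros cont f g' that)
    from compact_uniform_gap[OF chart_compact_image[OF M(1) c K] this D[OF that]] show ?thesis .
  qed
  then obtain \<eta> where \<eta>: "\<And>vs. vs \<in> L \<Longrightarrow> \<eta> vs > 0"
    "\<And>vs x. vs \<in> L \<Longrightarrow> x \<in> \<phi> ` K \<Longrightarrow> ?D vs x + \<eta> vs \<le> \<epsilon>"
    by metis
  show ?thesis
  proof (rule that[of "Min (\<eta> ` L)"])
    show "Min (\<eta> ` L) > 0" using L \<eta>(1) by (subst Min_gr_iff) auto
    show "whitney_nbhd M N g {((U, \<phi>), K, (V, \<psi>), Min (\<eta> ` L))} r
        \<subseteq> whitney_nbhd M N f {((U, \<phi>), K, (V, \<psi>), \<epsilon>)} r"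
    proof
      fix h assume h: "h \<in> whitney_nbhd M N g {((U, \<phi>), K, (V, \<psi>), Min (\<eta> ` L))} r"
      let ?h = "in_charts (U, \<phi>) (V, \<psi>) h"
      note h_nbhd = h[unfolded whitney_nbhd_single]
      have "norm (partials ?H ?f vs x - partials ?H ?h vs x) < \<epsilon>" if "x \<in> \<phi> ` K" "vs \<in> L" for x vs
      proof -
        have "norm (partials ?H ?g vs x - partials ?H ?h vs x) < Min (\<eta> ` L)"
          using h_nbhd that(2)[unfolded L_def mem_Collect_eq] that(1) by blast
        also have "\<dots> \<le> \<eta> vs" using L that by simp
        finally have "norm (partials ?H ?g vs x - partials ?H ?h vs x) < \<eta> vs" .
        moreover have "norm (partials ?H ?f vs x - partials ?H ?h vs x)
            \<le> ?D vs x + norm (partials ?H ?g vs x - partials ?H ?h vs x)"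
          using dist_triangle[of "partials ?H ?f vs x" "partials ?H ?h vs x" "partials ?H ?g vs x"]
          by (simp only: dist_norm)
        ultimately show ?thesis using \<eta>(2)[OF that(2,1)] by linarith
      qed
      then show "h \<in> whitney_nbhd M N f {((U, \<phi>), K, (V, \<psi>), \<epsilon>)} r"
        unfolding whitney_nbhd_single using h_nbhd by (simp add: L_def)
    qed
  qed
qed

lemma whitney_familyD:
  assumes "whitney_family M N f \<Phi>" "((U, \<phi>), K, (V, \<psi>), \<epsilon>) \<in> \<Phi>"
  shows "(U, \<phi>) \<in> mfd_charts M" "(V, \<psi>) \<in> mfd_charts N" "compactin (mfd_top M) K"
    "K \<subseteq> U" "f ` K \<subseteq> V"
  using bspec[OF conjunct1[OF assms(1)[unfolded whitney_family_def]] assms(2)] by simp_all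

text \<open>
  Local finiteness and compactness leave finitely many tuples, apart from those with an empty chart
  domain; these impose no condition.
\<close>

lemma whitney_family_finite:
  assumes M: "smooth_manifold M" "compact_space (mfd_top M)" and \<Phi>: "whitney_family M N f \<Phi>"
  shows "finite {d \<in> \<Phi>. fst (fst d) \<noteq> {}}"
proof -
  let ?meet = "\<lambda>W. {((U, \<phi>), d). ((U, \<phi>), d) \<in> \<Phi> \<and> U \<inter> W \<noteq> {}}"
  let ?\<U> = "{W. openin (mfd_top M) W \<and> finite (?meet W)}"
  have "points M \<subseteq> \<Union> ?\<U>"
  proof
    fix x assume "x \<in> points M"
    then obtain W where "openin (mfd_top M) W" "x \<in> W" "finite (?meet W)"
      using \<Phi> unfolding whitney_family_def by meson
    then show "x \<in> \<Union> ?\<U>" by blast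
  qed
  then obtain \<F> where \<F>: "finite \<F>" "\<F> \<subseteq> ?\<U>" "points M \<subseteq> \<Union>\<F>"
    using M(2) unfolding compact_space_alt by (metis (no_types, lifting) mem_Collect_eq)
  have "{d \<in> \<Phi>. fst (fst d) \<noteq> {}} \<subseteq> (\<Union>W\<in>\<F>. ?meet W)"
  proof
    fix e assume e: "e \<in> {d \<in> \<Phi>. fst (fst d) \<noteq> {}}"
    obtain U \<phi> K V \<psi> \<epsilon> where e_eq: "e = ((U, \<phi>), K, (V, \<psi>), \<epsilon>)" by (metis surj_pair)
    have "(U, \<phi>) \<in> mfd_charts M"
      using whitney_familyD(1)[OF \<Phi>, of U \<phi> K V \<psi> \<epsilon>] e by (simp add: e_eq)
    then have "U \<subseteq> points M" using chart_subset[OF M(1)] by blast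
    moreover obtain x where "x \<in> U" using e e_eq by auto
    ultimately obtain W where "W \<in> \<F>" "x \<in> W" using \<F>(3) by blast
    then show "e \<in> (\<Union>W\<in>\<F>. ?meet W)" using e \<open>x \<in> U\<close> unfolding e_eq by auto
  qed
  moreover have "finite (\<Union>W\<in>\<F>. ?meet W)" using \<F>(1,2) by (intro finite_UN_I) auto
  ultimately show ?thesis by (rule finite_subset)
qed

text \<open>
  By refinement around the image point and finiteness of the families, continuity at \<open>x\<close> needs to be
  checked only for a single tuple and a neighbourhood centred at \<open>T x\<close>.
\<close>

lemma continuous_map_into_whitney_topology:
  assumes M: "smooth_manifold M" "axis_thick (mfd_model M)" "compact_space (mfd_top M)"
    and N: "\<And>V \<psi>. (V, \<psi>) \<in> mfd_charts N \<Longrightarrow> openin (mfd_top N) V"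
    and T: "\<And>x. x \<in> topspace X \<Longrightarrow> T x \<in> smooth_maps M N"
    and step: "\<And>x U \<phi> K V \<psi> \<epsilon> r. x \<in> topspace X \<Longrightarrow> (U, \<phi>) \<in> mfd_charts M \<Longrightarrow> (V, \<psi>) \<in> mfd_charts N \<Longrightarrow>
       compactin (mfd_top M) K \<Longrightarrow> K \<subseteq> U \<Longrightarrow> T x ` K \<subseteq> V \<Longrightarrow> \<epsilon> > 0 \<Longrightarrow>
       \<exists>G. openin X G \<and> x \<in> G \<and> (\<forall>y\<in>G. T y \<in> whitney_nbhd M N (T x) {((U, \<phi>), K, (V, \<psi>), \<epsilon>)} r)"
  shows "continuous_map X (whitney_topology M N) T"
  unfolding whitney_topology_def
proof (rule continuous_on_generated_topo)
  show "T ` topspace X \<subseteq> \<Union> {whitney_nbhd M N f \<Phi> r |f \<Phi> r. f \<in> smooth_maps M N \<and> whitney_family M N f \<Phi>}"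
  proof -
    have eq: "smooth_maps M N =
        \<Union> {whitney_nbhd M N f \<Phi> r |f \<Phi> r. f \<in> smooth_maps M N \<and> whitney_family M N f \<Phi>}"
      using topspace_whitney_topology[of M N]
      unfolding whitney_topology_def topology_generated_by_topspace by (rule sym)
    show ?thesis unfolding eq[symmetric] by (rule image_subsetI) (rule T)
  qed
next
  fix B assume "B \<in> {whitney_nbhd M N f \<Phi> r |f \<Phi> r. f \<in> smooth_maps M N \<and> whitney_family M N f \<Phi>}"
  then obtain f \<Phi> r where B: "B = whitney_nbhd M N f \<Phi> r" and f: "f \<in> smooth_maps M N"
    and \<Phi>: "whitney_family M N f \<Phi>"
    unfolding mem_Collect_eq by (elim exE conjE)
  let ?\<Phi> = "{d \<in> \<Phi>. fst (fst d) \<noteq> {}}"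
  have fin: "finite ?\<Phi>" by (rule whitney_family_finite[OF M(1,3) \<Phi>])
  show "openin X (T -` B \<inter> topspace X)"
  proof (subst openin_subopen, rule ballI)
    fix x assume x: "x \<in> T -` B \<inter> topspace X"
    have "\<exists>G. openin X G \<and> x \<in> G \<and> (\<forall>y\<in>G. T y \<in> whitney_nbhd M N f {e} r)" if "e \<in> ?\<Phi>" for e
    proof -
      obtain U \<phi> K V \<psi> \<epsilon> where e: "e = ((U, \<phi>), K, (V, \<psi>), \<epsilon>)" by (metis surj_pair)
      have data: "(U, \<phi>) \<in> mfd_charts M" "(V, \<psi>) \<in> mfd_charts N" "compactin (mfd_top M) K" "K \<subseteq> U" "f ` K \<subseteq> V"
        using that whitney_familyD[OF \<Phi>, of U \<phi> K V \<psi> \<epsilon>] by (simp_all add: e)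
      have Tx: "T x \<in> whitney_nbhd M N f {((U, \<phi>), K, (V, \<psi>), \<epsilon>)} r"
      proof -
        have "T x \<in> whitney_nbhd M N f \<Phi> r" using x B by simp
        then show ?thesis
          using that unfolding whitney_nbhd_iff_single[of _ M N f \<Phi>] e[symmetric] by simp
      qed
      obtain \<eta> where "\<eta> > 0" and sub: "whitney_nbhd M N (T x) {((U, \<phi>), K, (V, \<psi>), \<eta>)} r
          \<subseteq> whitney_nbhd M N f {((U, \<phi>), K, (V, \<psi>), \<epsilon>)} r"
        using whitney_nbhd_refine[OF M(1,2) data(1,2) N[OF data(2)] data(3,4) f data(5) Tx] by blast
      have TxK: "T x ` K \<subseteq> V"
        using Tx unfolding whitney_nbhd_single by (elim conjE)
      have "x \<in> topspace X" using x by simp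
      from step[OF this data(1,2,3,4) TxK \<open>\<eta> > 0\<close>, of r]
      obtain G where "openin X G" "x \<in> G"
        "\<forall>y\<in>G. T y \<in> whitney_nbhd M N (T x) {((U, \<phi>), K, (V, \<psi>), \<eta>)} r"
        by (elim exE conjE)
      then show ?thesis using sub unfolding e by (intro exI[of _ G]) (simp add: subsetD)
    qed
    then have "\<forall>e\<in>?\<Phi>. \<exists>G. openin X G \<and> x \<in> G \<and> (\<forall>y\<in>G. T y \<in> whitney_nbhd M N f {e} r)"
      by (intro ballI)
    from bchoice[OF this] obtain G where
      "\<forall>e\<in>?\<Phi>. openin X (G e) \<and> x \<in> G e \<and> (\<forall>y\<in>G e. T y \<in> whitney_nbhd M N f {e} r)"
      by (rule exE)
    note G_all = bspec[OF this]
    note G = conjunct1[OF G_all] conjunct1[OF conjunct2[OF G_all]]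
      bspec[OF conjunct2[OF conjunct2[OF G_all]]]
    let ?G = "topspace X \<inter> \<Inter> (G ` ?\<Phi>)"
    have "openin X ?G"
    proof (cases "?\<Phi> = {}")
      case True
      show ?thesis unfolding True by simp
    next
      case False
      have "openin X (\<Inter> (G ` ?\<Phi>))"
      proof (rule openin_Inter)
        show "finite (G ` ?\<Phi>)" by (rule finite_imageI[OF fin])
        show "G ` ?\<Phi> \<noteq> {}" using False by (simp only: image_is_empty not_False_eq_True)
        show "openin X S" if S: "S \<in> G ` ?\<Phi>" for S
        proof -
          obtain e where "S = G e" "e \<in> ?\<Phi>" using S by (rule imageE)
          then show ?thesis using G(1) by simp
        qed
      qed
      then show ?thesis by (intro openin_Int openin_topspace)
    qed
    moreover have "x \<in> ?G"
      using x by (intro IntI INT_I G(2)) simp_all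
    moreover have in_B: "T y \<in> B" if y: "y \<in> ?G" for y
      unfolding B
    proof (subst whitney_nbhd_iff_single, intro conjI ballI)
      show Ty: "T y \<in> smooth_maps M N" using y by (intro T) simp
      fix e assume e: "e \<in> \<Phi>"
      show "T y \<in> whitney_nbhd M N f {e} r"
      proof (cases "fst (fst e) = {}")
        case False
        then have "e \<in> ?\<Phi>" using e by simp
        from G(3)[OF this INT_D[OF IntD2[OF y] this]] show ?thesis .
      next
        case True
        obtain U \<phi> K V \<psi> \<epsilon> where e_eq: "e = ((U, \<phi>), K, (V, \<psi>), \<epsilon>)" by (metis surj_pair)
        have "K \<subseteq> U" by (rule whitney_familyD(4)[OF \<Phi> e[unfolded e_eq]])
        then have "K = {}" using True e_eq by simp
        then show ?thesis unfolding e_eq whitney_nbhd_single using Ty by simp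
      qed
    qed
    moreover have "?G \<subseteq> T -` B \<inter> topspace X"
    proof
      fix y assume y: "y \<in> ?G"
      then have "y \<in> topspace X" by (rule IntD1)
      with in_B[OF y] show "y \<in> T -` B \<inter> topspace X" by simp
    qed
    ultimately show "\<exists>G. openin X G \<and> x \<in> G \<and> G \<subseteq> T -` B \<inter> topspace X"
      by (intro exI[of _ ?G] conjI)
  qed
qed

section \<open>Composing with the covering map\<close>

abbreviation cover_map :: "('a, 'e::euclidean_space) manifold \<Rightarrow> ('a \<Rightarrow> real) \<Rightarrow> 'a \<Rightarrow> complex" where
  "cover_map M u \<equiv> restrict (circle_cover \<circ> u) (points M)"

lemma in_charts_real_line: "in_charts (U, \<phi>) (UNIV, \<lambda>x. x) u = u \<circ> inv_into U \<phi>"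
  by (simp add: in_charts_def comp_def)

lemma openin_real_line_chart: "(V, \<psi>) \<in> mfd_charts real_line \<Longrightarrow> openin (mfd_top real_line) V"
  by (simp add: real_line_def generated_atlas_def is_chart_def)

lemma openin_circle_chart: "(V, \<psi>) \<in> mfd_charts circle \<Longrightarrow> openin (mfd_top circle) V"
  by (simp add: circle_def generated_atlas_def is_chart_def)

lemma smooth_map_real_line_continuous:
  "u \<in> smooth_maps M real_line \<Longrightarrow> continuous_map (mfd_top M) euclideanreal u"
  using smooth_mapsD(2)[of u M real_line] by (simp add: real_line_def)

lemma cover_map_smooth:
  assumes "smooth_manifold M" "u \<in> smooth_maps M real_line"
  shows "cover_map M u \<in> smooth_maps M circle"
  using smooth_map_circle_iff[OF assms(1) smooth_mapsD(1)[OF assms(2)]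
      smooth_map_real_line_continuous[OF assms(2)]] assms(2) by blast

text \<open>
  In a chart \<open>\<psi>\<close> of the circle, \<open>cover_map M u\<close> is the composite of the smooth function
  \<open>\<psi> \<circ> circle_cover\<close> with \<open>u\<close>, and composition with a smooth function is continuous.
\<close>

lemma continuous_map_cover_map:
  fixes M :: "('a, 'e::euclidean_space) manifold"
  assumes M: "smooth_manifold M" "axis_thick (mfd_model M)" "compact_space (mfd_top M)"
  shows "continuous_map (whitney_topology M real_line) (whitney_topology M circle) (cover_map M)"
proof (rule continuous_map_into_whitney_topology[OF M openin_circle_chart])
  show "cover_map M u \<in> smooth_maps M circle" if "u \<in> topspace (whitney_topology M real_line)" for u
    using that cover_map_smooth[OF M(1)] by (simp add: topspace_whitney_topology)
next
  fix u U \<phi> K V \<psi> r and \<epsilon> :: real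
  assume u: "u \<in> topspace (whitney_topology M real_line)" and c: "(U, \<phi>) \<in> mfd_charts M"
    and d: "(V, \<psi>) \<in> mfd_charts circle" and K: "compactin (mfd_top M) K" "K \<subseteq> U"
    and KV: "cover_map M u ` K \<subseteq> V" and "\<epsilon> > 0"
  let ?H = "mfd_model M"
  have u: "u \<in> smooth_maps M real_line" using u by (simp add: topspace_whitney_topology)
  have a: "smooth_within ?H (\<phi> ` U) (u' \<circ> inv_into U \<phi>)" if "u' \<in> smooth_maps M real_line" for u'
    by (rule smooth_within_real_line[OF M(1,2) that c])
  have cov: "cover_map M u' x = circle_cover (u' x)" if "x \<in> U" for u' x
    using chart_subset[OF M(1) c] that by auto
  have \<phi>K: "compact (\<phi> ` K)" "\<phi> ` K \<subseteq> \<phi> ` U"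
    using chart_compact_image[OF M(1) c K] K(2) by auto
  have im: "(u \<circ> inv_into U \<phi>) ` (\<phi> ` K) \<subseteq> circle_cover -` V"
  proof
    fix s assume "s \<in> (u \<circ> inv_into U \<phi>) ` (\<phi> ` K)"
    then obtain x where x: "x \<in> K" "s = u x" using K(2) by (auto simp: chart_inv_into_eq[OF M(1) c])
    then have "circle_cover (u x) \<in> V" using KV cov[of x u] K(2) by (metis image_subset_iff subsetD)
    then show "s \<in> circle_cover -` V" using x by simp
  qed
  have loc: "partials ?H (in_charts (U, \<phi>) (V, \<psi>) (cover_map M u')) vs y =
      partials ?H ((\<psi> \<circ> circle_cover) \<circ> (u' \<circ> inv_into U \<phi>)) vs y"
    if "y \<in> \<phi> ` K" "u' \<in> smooth_maps M real_line" for u' vs y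
  proof (rule partials_cong_openin[OF smooth_within_openin[OF a[OF that(2)]]])
    show "y \<in> \<phi> ` U" using that \<phi>K by blast
    fix z assume "z \<in> \<phi> ` U"
    then show "in_charts (U, \<phi>) (V, \<psi>) (cover_map M u') z = ((\<psi> \<circ> circle_cover) \<circ> (u' \<circ> inv_into U \<phi>)) z"
      using cov[OF chart_inv_into[OF M(1) c], of z u'] by (simp add: in_charts_def)
  qed
  obtain \<delta> r' where "\<delta> > 0" and
    *: "\<And>b x. smooth_within ?H (\<phi> ` U) b \<Longrightarrow>
       (\<And>x vs. x \<in> \<phi> ` K \<Longrightarrow> set vs \<subseteq> Basis \<Longrightarrow> length vs \<le> r' \<Longrightarrow>
          norm (partials ?H (u \<circ> inv_into U \<phi>) vs x - partials ?H b vs x) < \<delta>) \<Longrightarrow> x \<in> \<phi> ` K \<Longrightarrow>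
       b x \<in> circle_cover -` V \<and> (\<forall>vs. set vs \<subseteq> Basis \<and> length vs \<le> r \<longrightarrow>
         norm (partials ?H ((\<psi> \<circ> circle_cover) \<circ> (u \<circ> inv_into U \<phi>)) vs x
             - partials ?H ((\<psi> \<circ> circle_cover) \<circ> b) vs x) < \<epsilon>)"
    using smooth_close_compose[OF M(2) \<phi>K a[OF u] circle_chart_smooth[OF d] im \<open>\<epsilon> > 0\<close>] by metis
  let ?G = "whitney_nbhd M real_line u {((U, \<phi>), K, (UNIV, \<lambda>x. x), \<delta>)} r'"
  have "openin (whitney_topology M real_line) ?G"
    by (rule openin_whitney_nbhd_single[OF u c real_line_chart_id K _ \<open>\<delta> > 0\<close>]) simp
  moreover have "u \<in> ?G" using u \<open>\<delta> > 0\<close> by (intro whitney_nbhd_self) auto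
  moreover have "cover_map M u' \<in> whitney_nbhd M circle (cover_map M u) {((U, \<phi>), K, (V, \<psi>), \<epsilon>)} r"
    if "u' \<in> ?G" for u'
  proof -
    have u': "u' \<in> smooth_maps M real_line"
      and close: "\<And>x vs. x \<in> \<phi> ` K \<Longrightarrow> set vs \<subseteq> Basis \<Longrightarrow> length vs \<le> r' \<Longrightarrow>
          norm (partials ?H (u \<circ> inv_into U \<phi>) vs x - partials ?H (u' \<circ> inv_into U \<phi>) vs x) < \<delta>"
      using that unfolding whitney_nbhd_single in_charts_real_line by blast+
    note ** = *[OF a[OF u'] close]
    show ?thesis
      unfolding whitney_nbhd_single
    proof (intro conjI ballI allI impI)
      show "cover_map M u' \<in> smooth_maps M circle" by (rule cover_map_smooth[OF M(1) u'])
      show "cover_map M u' ` K \<subseteq> V"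
      proof
        fix z assume "z \<in> cover_map M u' ` K"
        then obtain x where x: "x \<in> K" "z = cover_map M u' x" by blast
        then have "x \<in> U" using K(2) by blast
        then show "z \<in> V"
          using **[of "\<phi> x"] x cov[of x u'] by (simp add: chart_inv_into_eq[OF M(1) c])
      qed
      fix y and vs :: "'e list" assume y: "y \<in> \<phi> ` K" and vs: "set vs \<subseteq> Basis \<and> length vs \<le> r"
      show "norm (partials ?H (in_charts (U, \<phi>) (V, \<psi>) (cover_map M u)) vs y -
          partials ?H (in_charts (U, \<phi>) (V, \<psi>) (cover_map M u')) vs y) < \<epsilon>"
        unfolding loc[OF y u] loc[OF y u'] using **[OF _ _ _ y] vs by blast
    qed
  qed
  ultimately show "\<exists>G. openin (whitney_topology M real_line) G \<and> u \<in> G \<and>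
      (\<forall>y\<in>G. cover_map M y \<in> whitney_nbhd M circle (cover_map M u) {((U, \<phi>), K, (V, \<psi>), \<epsilon>)} r)"
    by (intro exI[of _ ?G]) blast
qed


section \<open>Recovering a lift from its composite with the covering map\<close>

text \<open>
  The pieces are the preimages of the intervals \<open>[j/2, j/2 + 1/2]\<close>; each lies well inside the open
  interval \<open>(j/2 - 1/4, j/2 + 3/4)\<close>, and only finitely many \<open>j\<close> occur since \<open>u\<close> is bounded on \<open>K\<close>.
\<close>

lemma compactin_arc_decomposition:
  assumes K: "compactin X K" and u: "continuous_map X euclideanreal u"
  obtains J where "finite J" "\<And>C a. (C, a) \<in> J \<Longrightarrow> compactin X C" "\<And>C a. (C, a) \<in> J \<Longrightarrow> C \<subseteq> K"
    "\<And>C a. (C, a) \<in> J \<Longrightarrow> u ` C \<subseteq> {a<..<a+1}" "\<And>x. x \<in> K \<Longrightarrow> \<exists>(C, a)\<in>J. x \<in> C"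
proof -
  define C where "C j = {x \<in> K. u x \<in> {of_int j / 2..of_int j / 2 + 1/2}}" for j :: int
  define a where "a j = of_int j / 2 - 1 / (4::real)" for j :: int
  have "compact (u ` K)"
    using image_compactin[OF K u] by simp
  then obtain B where B: "\<And>x. x \<in> K \<Longrightarrow> \<bar>u x\<bar> \<le> B"
    using compact_imp_bounded bounded_iff by (metis image_eqI real_norm_def)
  define I where "I = {\<lfloor>- 2 * B\<rfloor>..\<lfloor>2 * B\<rfloor>}"
  show ?thesis
  proof (rule that[of "(\<lambda>j. (C j, a j)) ` I"])
    show "finite ((\<lambda>j. (C j, a j)) ` I)" by (simp add: I_def)
    fix C' a' assume "(C', a') \<in> (\<lambda>j. (C j, a j)) ` I"
    then obtain j where j: "C' = C j" "a' = a j" by blast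
    show "C' \<subseteq> K" "u ` C' \<subseteq> {a'<..<a'+1}" by (auto simp: j C_def a_def)
    have "closedin X {x \<in> topspace X. u x \<in> {of_int j / 2..of_int j / 2 + 1/2}}"
      by (rule closedin_continuous_map_preimage[OF u]) simp
    then have "compactin X (K \<inter> {x \<in> topspace X. u x \<in> {of_int j / 2..of_int j / 2 + 1/2}})"
      using K by (simp add: compact_Int_closedin)
    moreover have "K \<inter> {x \<in> topspace X. u x \<in> {of_int j / 2..of_int j / 2 + 1/2}} = C j"
      using compactin_subset_topspace[OF K] by (auto simp: C_def)
    ultimately show "compactin X C'" by (simp add: j)
  next
    fix x assume x: "x \<in> K"
    let ?j = "\<lfloor>2 * u x\<rfloor>"
    have j: "of_int ?j \<le> 2 * u x" "2 * u x < of_int ?j + 1" by linarith+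
    have "of_int ?j / 2 \<le> u x" "u x \<le> of_int ?j / 2 + 1/2" using j by linarith+
    then have "x \<in> C ?j" using x by (simp add: C_def)
    moreover have "?j \<in> I"
      using B[OF x] unfolding I_def by (auto intro!: floor_mono)
    ultimately show "\<exists>(C, a)\<in>(\<lambda>j. (C j, a j)) ` I. x \<in> C" by blast
  qed
qed

text \<open>
  Compact Hausdorff spaces are regular, so each point has a closed, hence compact, neighbourhood inside
  a chart.
\<close>

lemma compact_chart_cover:
  assumes M: "smooth_manifold M" "compact_space (mfd_top M)"
  obtains F where "finite F" "\<And>c K. (c, K) \<in> F \<Longrightarrow> c \<in> mfd_charts M \<and> compactin (mfd_top M) K \<and> K \<subseteq> fst c"
    "\<And>x. x \<in> points M \<Longrightarrow> \<exists>(c, K)\<in>F. x \<in> K"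
proof -
  have reg: "neighbourhood_base_of (closedin (mfd_top M)) (mfd_top M)"
    using M compact_Hausdorff_imp_regular_space neighbourhood_base_of_closedin
    unfolding smooth_manifold_def by blast
  have "\<exists>c K W. c \<in> mfd_charts M \<and> compactin (mfd_top M) K \<and> K \<subseteq> fst c \<and> openin (mfd_top M) W \<and>
      x \<in> W \<and> W \<subseteq> K" if "x \<in> points M" for x
  proof -
    have "x \<in> (\<Union>(U, \<phi>)\<in>mfd_charts M. U)" using M(1) that unfolding smooth_manifold_def by simp
    then obtain U \<phi> where c: "(U, \<phi>) \<in> mfd_charts M" "x \<in> U" by blast
    obtain W K where WK: "openin (mfd_top M) W" "closedin (mfd_top M) K" "x \<in> W" "W \<subseteq> K" "K \<subseteq> U"
      using reg[unfolded neighbourhood_base_of, rule_format, of U x] chart_openin[OF M(1) c(1)] c(2) by blast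
    then show ?thesis
      using c closedin_compact_space[OF M(2)] by (intro exI[of _ "(U, \<phi>)"] exI[of _ K] exI[of _ W]) simp
  qed
  then obtain c K W where ckw: "\<And>x. x \<in> points M \<Longrightarrow> c x \<in> mfd_charts M \<and> compactin (mfd_top M) (K x) \<and>
      K x \<subseteq> fst (c x) \<and> openin (mfd_top M) (W x) \<and> x \<in> W x \<and> W x \<subseteq> K x"
    by metis
  have "\<exists>\<F>. finite \<F> \<and> \<F> \<subseteq> W ` points M \<and> points M \<subseteq> \<Union> \<F>"
  proof (rule M(2)[unfolded compact_space_alt, rule_format], intro conjI ballI)
    show "openin (mfd_top M) V" if "V \<in> W ` points M" for V
      using that ckw by blast
    show "points M \<subseteq> \<Union> (W ` points M)" using ckw by blast
  qed
  then obtain A where A: "finite A" "A \<subseteq> points M" "points M \<subseteq> \<Union> (W ` A)"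
    by (metis finite_subset_image)
  show ?thesis
  proof (rule that[of "(\<lambda>x. (c x, K x)) ` A"])
    show "finite ((\<lambda>x. (c x, K x)) ` A)" using A by simp
    fix c' K' assume "(c', K') \<in> (\<lambda>x. (c x, K x)) ` A"
    then obtain x where "x \<in> A" "c' = c x" "K' = K x" by blast
    then show "c' \<in> mfd_charts M \<and> compactin (mfd_top M) K' \<and> K' \<subseteq> fst c'" using ckw[of x] A(2) by auto
  next
    fix y assume "y \<in> points M"
    then obtain x where x: "x \<in> A" "y \<in> W x" using A(3) by blast
    then have "y \<in> K x" using ckw[of x] A(2) by blast
    then show "\<exists>(c, K)\<in>(\<lambda>x. (c x, K x)) ` A. y \<in> K" using x(1) by auto
  qed
qed

text \<open>
  The angle charts of the circle see only maps with values in an arc, so \<open>K\<close> is cut into finitely many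
  pieces on which \<open>u\<close> takes values in an interval of length \<open>1\<close>, and closeness is prescribed on each of
  them in the corresponding angle.
\<close>

lemma cover_map_nbhd:
  fixes M :: "('a, 'e::euclidean_space) manifold" and K :: "'a set"
  assumes M: "smooth_manifold M" and u: "u \<in> smooth_maps M real_line"
    and c: "(U, \<phi>) \<in> mfd_charts M" and K: "compactin (mfd_top M) K" "K \<subseteq> U" and "\<delta> > 0"
  obtains G where "openin (whitney_topology M circle) G" "cover_map M u \<in> G"
    "\<And>w x. w \<in> G \<Longrightarrow> x \<in> K \<Longrightarrow> \<exists>C a. x \<in> C \<and> C \<subseteq> K \<and> u ` C \<subseteq> {a<..<a+1} \<and>
      w \<in> whitney_nbhd M circle (cover_map M u) {((U, \<phi>), C, (circle_arc a, arc_angle a), \<delta>)} r"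
proof -
  obtain J where J: "finite J" "\<And>C a. (C, a) \<in> J \<Longrightarrow> compactin (mfd_top M) C"
    "\<And>C a. (C, a) \<in> J \<Longrightarrow> C \<subseteq> K" "\<And>C a. (C, a) \<in> J \<Longrightarrow> u ` C \<subseteq> {a<..<a+1}"
    "\<And>x. x \<in> K \<Longrightarrow> \<exists>(C, a)\<in>J. x \<in> C"
    using compactin_arc_decomposition[OF K(1) smooth_map_real_line_continuous[OF u]] by blast
  define B where "B = (\<lambda>(C, a). whitney_nbhd M circle (cover_map M u)
      {((U, \<phi>), C, (circle_arc a, arc_angle a), \<delta>)} r)"
  have cu: "cover_map M u \<in> smooth_maps M circle" by (rule cover_map_smooth[OF M u])
  have im: "cover_map M u ` C \<subseteq> circle_arc a" if "(C, a) \<in> J" for C a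
  proof
    fix z assume "z \<in> cover_map M u ` C"
    then obtain x where x: "x \<in> C" "z = cover_map M u x" by blast
    then have "x \<in> points M" using J(3)[OF that] K(2) chart_subset[OF M c] by blast
    then show "z \<in> circle_arc a" using x J(4)[OF that] by auto
  qed
  let ?G = "smooth_maps M circle \<inter> \<Inter> (B ` J)"
  have openB: "openin (whitney_topology M circle) (B e)" if e: "e \<in> J" for e
  proof -
    obtain C a where ea: "e = (C, a)" by (metis surj_pair)
    have CU: "C \<subseteq> U" using J(3)[OF e[unfolded ea]] K(2) by blast
    show ?thesis unfolding ea B_def split
      by (rule openin_whitney_nbhd_single[OF cu c circle_chart_arc J(2)[OF e[unfolded ea]] CU
            im[OF e[unfolded ea]] \<open>\<delta> > 0\<close>])
  qed
  have topM: "openin (whitney_topology M circle) (smooth_maps M circle)"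
    by (metis openin_topspace topspace_whitney_topology)
  show ?thesis
  proof (rule that[of ?G])
    show "openin (whitney_topology M circle) ?G"
    proof (cases "J = {}")
      case True
      then show ?thesis using topM by simp
    next
      case False
      then show ?thesis
        using J(1) openB by (intro openin_Int[OF topM] openin_Inter) auto
    qed
    have "cover_map M u \<in> B e" if e: "e \<in> J" for e
    proof -
      obtain C a where ea: "e = (C, a)" by (metis surj_pair)
      show ?thesis unfolding ea B_def split
        by (rule whitney_nbhd_self[OF cu im[OF e[unfolded ea]] \<open>\<delta> > 0\<close>])
    qed
    then show "cover_map M u \<in> ?G" using cu by blast
    fix w x assume w: "w \<in> ?G" and "x \<in> K"
    then obtain C a where Ca: "(C, a) \<in> J" "x \<in> C" using J(5) by blast
    moreover have "w \<in> B (C, a)" using w Ca(1) by blast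
    ultimately show "\<exists>C a. x \<in> C \<and> C \<subseteq> K \<and> u ` C \<subseteq> {a<..<a+1} \<and>
        w \<in> whitney_nbhd M circle (cover_map M u) {((U, \<phi>), C, (circle_arc a, arc_angle a), \<delta>)} r"
      using J(3,4)[OF Ca(1)] unfolding B_def split by blast
  qed
qed

text \<open>
  The values of \<open>d\<close> form an interval that contains no half-integer.
\<close>

lemma connected_near_integers_constant:
  assumes X: "connected_space X" and d: "continuous_map X euclideanreal d"
    and near: "\<And>x. x \<in> topspace X \<Longrightarrow> \<exists>k::int. \<bar>d x - of_int k\<bar> < 1/4"
  obtains k :: int where "\<And>x. x \<in> topspace X \<Longrightarrow> \<bar>d x - of_int k\<bar> < 1/4"
proof (cases "topspace X = {}")
  case True
  then show ?thesis using that by simp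
next
  case False
  then obtain x0 where x0: "x0 \<in> topspace X" by blast
  then obtain k where k: "\<bar>d x0 - of_int k\<bar> < 1/4" using near by blast
  have "connectedin euclideanreal (d ` topspace X)"
    using connectedin_continuous_map_image[OF d] X by (simp add: connectedin_topspace)
  then have conn: "connected (d ` topspace X)" by simp
  have no_half: "of_int m + 1/2 \<notin> d ` topspace X" for m :: int
  proof
    assume "of_int m + 1/2 \<in> d ` topspace X"
    then obtain x where x: "x \<in> topspace X" "d x = of_int m + 1/2" by force
    obtain l :: int where "\<bar>d x - of_int l\<bar> < 1/4" using near[OF x(1)] by blast
    then have "of_int (l - m) < (1::real)" "(0::real) < of_int (l - m)"
      using x(2) unfolding of_int_diff abs_less_iff by linarith+
    then have "l - m < 1" "0 < l - m" by simp_all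
    then show False by linarith
  qed
  have "\<bar>d x - of_int k\<bar> < 1/4" if x: "x \<in> topspace X" for x
  proof -
    obtain l :: int where l: "\<bar>d x - of_int l\<bar> < 1/4" using near[OF x] by blast
    have "\<not> k < l"
    proof
      assume "k < l"
      then have "of_int k + 1 \<le> (of_int l :: real)" by linarith
      then have "d x0 \<le> of_int k + 1/2" "of_int k + 1/2 \<le> d x" using k l by linarith+
      then have "of_int k + 1/2 \<in> d ` topspace X"
        using conn x0 x unfolding connected_iff_interval by (meson imageI)
      then show False using no_half by blast
    qed
    moreover have "\<not> l < k"
    proof
      assume "l < k"
      then have "of_int l + 1 \<le> (of_int k :: real)" by linarith
      then have "d x \<le> of_int l + 1/2" "of_int l + 1/2 \<le> d x0" using k l by linarith+
      then have "of_int l + 1/2 \<in> d ` topspace X"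
        using conn x0 x unfolding connected_iff_interval by (meson imageI)
      then show False using no_half by blast
    qed
    ultimately have "l = k" by simp
    then show ?thesis using l by simp
  qed
  then show ?thesis using that by blast
qed

text \<open>
  If two lifts agree up to small errors modulo integers, then they differ by nearly the same integer
  \<open>k\<close> everywhere. Both attain the same maximum. Where \<open>u\<close> attains it \<open>u'\<close> cannot be larger, which excludes
  \<open>k \<ge> 1\<close>; where \<open>u'\<close> attains it \<open>u\<close> cannot be larger, which excludes \<open>k \<le> -1\<close>.
\<close>

lemma lifts_with_equal_image_close:
  assumes X: "connected_space X" "compact_space X"
    and u: "continuous_map X euclideanreal u" "continuous_map X euclideanreal u'"
    and im: "u' ` topspace X = u ` topspace X"
    and near: "\<And>x. x \<in> topspace X \<Longrightarrow> \<exists>k::int. \<bar>u' x - u x - of_int k\<bar> < 1/4"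
    and x: "x \<in> topspace X"
  shows "\<bar>u' x - u x\<bar> < 1/4"
proof -
  have "continuous_map X euclideanreal (\<lambda>x. u' x - u x)"
    using u by (intro continuous_map_diff)
  from connected_near_integers_constant[OF X(1) this near]
  obtain k :: int where k: "\<And>x. x \<in> topspace X \<Longrightarrow> \<bar>u' x - u x - of_int k\<bar> < 1/4" by blast
  have "compactin euclideanreal (u ` topspace X)"
    using image_compactin[OF _ u(1)] X(2) by (simp add: compact_space_def)
  then have "compact (u ` topspace X)" by simp
  moreover have "u ` topspace X \<noteq> {}" using x by blast
  ultimately obtain s where s: "s \<in> u ` topspace X" "\<And>t. t \<in> u ` topspace X \<Longrightarrow> t \<le> s"
    by (meson compact_attains_sup)
  obtain y where y: "y \<in> topspace X" "u y = s" using s(1) by blast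
  obtain z where z: "z \<in> topspace X" "u' z = s" using s(1) im by (metis imageE)
  have "u' y \<le> s" using s(2) y(1) im by blast
  then have "of_int k < (1::real)" using k[OF y(1)] y(2) by linarith
  moreover have "u z \<le> s" using s(2) z(1) by blast
  then have "(-1::real) < of_int k" using k[OF z(1)] z(2) by linarith
  ultimately have "k = 0" by linarith
  then show ?thesis using k[OF x] by simp
qed

text \<open>
  On all smooth functions this fails, as \<open>u\<close> and \<open>u + 1\<close> have the same composite; an equal image rules
  out the integer translations.
\<close>

lemma cover_map_injective:
  assumes X: "connected_space (mfd_top M)" "compact_space (mfd_top M)"
    and u: "u \<in> smooth_maps M real_line" "u' \<in> smooth_maps M real_line"
    and im: "u' ` points M = u ` points M" and eq: "cover_map M u = cover_map M u'"
  shows "u = u'"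
proof (rule extensionalityI[OF smooth_mapsD(1)[OF u(1)] smooth_mapsD(1)[OF u(2)]])
  fix x assume x: "x \<in> points M"
  have int: "u' y - u y \<in> \<int>" if "y \<in> points M" for y
    using fun_cong[OF eq, of y] that by (simp add: circle_cover_eq_iff[symmetric])
  have "\<bar>u' x - u x\<bar> < 1/4"
  proof (rule lifts_with_equal_image_close[OF X _ _ im _ x])
    show "\<exists>k::int. \<bar>u' y - u y - of_int k\<bar> < 1/4" if "y \<in> points M" for y
    proof -
      have "u' y - u y \<in> \<int>" by (rule int[OF that])
      then obtain k where "u' y - u y = of_int k" by (rule Ints_cases)
      then show ?thesis by (intro exI[of _ k]) simp
    qed
  qed (intro smooth_map_real_line_continuous u)+
  moreover have "u' x - u x \<in> \<int>" by (rule int[OF x])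
  then obtain k where k: "u' x - u x = of_int k" by (rule Ints_cases)
  ultimately have "\<bar>of_int k\<bar> < (1/4::real)" by simp
  then have "k = 0" by linarith
  then show "u x = u' x" using k by simp
qed

text \<open>
  What closeness in order \<open>0\<close> in an angle chart says about lifts: they are close up to an integer.
\<close>

lemma whitney_nbhd_arcD:
  fixes M :: "('a, 'e::euclidean_space) manifold"
  assumes M: "smooth_manifold M" and c: "(U, \<phi>) \<in> mfd_charts M" and C: "C \<subseteq> U" and x: "x \<in> C"
    and uC: "u ` C \<subseteq> {a<..<a+1}"
    and w: "cover_map M u' \<in> whitney_nbhd M circle (cover_map M u) {((U, \<phi>), C, (circle_arc a, arc_angle a), \<delta>)} r"
  shows "\<exists>k::int. u' x + of_int k \<in> {a<..<a+1} \<and> \<bar>u' x + of_int k - u x\<bar> < \<delta>"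
proof -
  have xU: "x \<in> U" "x \<in> points M" using C x chart_subset[OF M c] by auto
  have "cover_map M u' ` C \<subseteq> circle_arc a" using w unfolding whitney_nbhd_single by blast
  then have "circle_cover (u' x) \<in> circle_arc a" using x xU by (auto simp: image_subset_iff)
  then obtain t where t: "t \<in> {a<..<a+1}" "circle_cover t = circle_cover (u' x)" by (metis imageE)
  then obtain k :: int where k: "t - u' x = of_int k"
    unfolding circle_cover_eq_iff by (rule_tac Ints_cases)
  have "norm (partials (mfd_model M) (in_charts (U, \<phi>) (circle_arc a, arc_angle a) (cover_map M u)) [] (\<phi> x)
      - partials (mfd_model M) (in_charts (U, \<phi>) (circle_arc a, arc_angle a) (cover_map M u')) [] (\<phi> x)) < \<delta>"
    using w x unfolding whitney_nbhd_single by (metis (no_types, lifting) empty_subsetI image_eqI le0 list.set(1) list.size(3))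
  then have "\<bar>arc_angle a (circle_cover (u x)) - arc_angle a (circle_cover (u' x))\<bar> < \<delta>"
    using xU by (simp add: in_charts_def chart_inv_into_eq[OF M c])
  moreover have "arc_angle a (circle_cover (u x)) = u x"
    using uC x by (intro arc_angle_circle_cover) blast
  moreover have "arc_angle a (circle_cover (u' x)) = t"
    unfolding t(2)[symmetric] by (rule arc_angle_circle_cover[OF t(1)])
  ultimately have "\<bar>u x - t\<bar> < \<delta>" by simp
  moreover have "u' x + of_int k = t" using k by simp
  ultimately show ?thesis using t(1) by (intro exI[of _ k]) (simp add: abs_minus_commute)
qed

text \<open>
  Uniform control over the whole of \<open>M\<close> is needed here even if closeness is wanted on a small set only:
  the integer ambiguity is a global matter and is resolved by comparing the maxima.
\<close>

lemma cover_map_nbhd_close: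
  fixes M :: "('a, 'e::euclidean_space) manifold"
  assumes M: "smooth_manifold M" "compact_space (mfd_top M)" "connected_space (mfd_top M)"
    and u: "u \<in> smooth_maps M real_line"
  obtains G where "openin (whitney_topology M circle) G" "cover_map M u \<in> G"
    "\<And>u' x. u' \<in> smooth_maps M real_line \<Longrightarrow> u' ` points M = u ` points M \<Longrightarrow> cover_map M u' \<in> G \<Longrightarrow>
       x \<in> points M \<Longrightarrow> \<bar>u' x - u x\<bar> < 1/4"
proof -
  obtain F where F: "finite F"
    "\<And>c K. (c, K) \<in> F \<Longrightarrow> c \<in> mfd_charts M \<and> compactin (mfd_top M) K \<and> K \<subseteq> fst c"
    "\<And>x. x \<in> points M \<Longrightarrow> \<exists>(c, K)\<in>F. x \<in> K"
    using compact_chart_cover[OF M(1,2)] by blast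
  have "\<exists>G. openin (whitney_topology M circle) G \<and> cover_map M u \<in> G \<and>
      (\<forall>u' x. cover_map M u' \<in> G \<and> x \<in> snd e \<longrightarrow> (\<exists>k::int. \<bar>u' x - u x - of_int k\<bar> < 1/4))"
    if e: "e \<in> F" for e
  proof -
    obtain U \<phi> K where eq: "e = ((U, \<phi>), K)" by (metis surj_pair)
    have c: "(U, \<phi>) \<in> mfd_charts M" and K: "compactin (mfd_top M) K" "K \<subseteq> U"
      using F(2)[OF e[unfolded eq]] by simp_all
    obtain G where G: "openin (whitney_topology M circle) G" "cover_map M u \<in> G"
      and GC: "\<And>w x. w \<in> G \<Longrightarrow> x \<in> K \<Longrightarrow> \<exists>C a. x \<in> C \<and> C \<subseteq> K \<and> u ` C \<subseteq> {a<..<a+1} \<and>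
        w \<in> whitney_nbhd M circle (cover_map M u) {((U, \<phi>), C, (circle_arc a, arc_angle a), 1/4)} 0"
      using cover_map_nbhd[OF M(1) u c K, of "1/4" 0] by auto
    have "\<exists>k::int. \<bar>u' x - u x - of_int k\<bar> < 1/4" if u': "cover_map M u' \<in> G" "x \<in> K" for u' x
    proof -
      obtain C a where C: "x \<in> C" "C \<subseteq> K" "u ` C \<subseteq> {a<..<a+1}"
        "cover_map M u' \<in> whitney_nbhd M circle (cover_map M u) {((U, \<phi>), C, (circle_arc a, arc_angle a), 1/4)} 0"
        using GC[OF u'] by blast
      have "C \<subseteq> U" using C(2) K(2) by simp
      from whitney_nbhd_arcD[OF M(1) c this C(1,3,4)]
      obtain k :: int where "\<bar>u' x + of_int k - u x\<bar> < 1/4" by blast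
      then show ?thesis by (intro exI[of _ "-k"]) (simp add: algebra_simps)
    qed
    then show ?thesis using G unfolding eq snd_conv by (intro exI[of _ G]) blast
  qed
  then obtain G where G: "\<And>e. e \<in> F \<Longrightarrow> openin (whitney_topology M circle) (G e)"
    "\<And>e. e \<in> F \<Longrightarrow> cover_map M u \<in> G e"
    "\<And>e u' x. e \<in> F \<Longrightarrow> cover_map M u' \<in> G e \<Longrightarrow> x \<in> snd e \<Longrightarrow> \<exists>k::int. \<bar>u' x - u x - of_int k\<bar> < 1/4"
    by metis
  let ?G = "smooth_maps M circle \<inter> \<Inter> (G ` F)"
  have topM: "openin (whitney_topology M circle) (smooth_maps M circle)"
    by (metis openin_topspace topspace_whitney_topology)
  show ?thesis
  proof (rule that[of ?G])
    show "openin (whitney_topology M circle) ?G"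
    proof (cases "F = {}")
      case True
      then show ?thesis using topM by simp
    next
      case False
      then show ?thesis using F(1) G(1) by (intro openin_Int[OF topM] openin_Inter) auto
    qed
    show "cover_map M u \<in> ?G" using G(2) cover_map_smooth[OF M(1) u] by blast
    fix u' x assume u': "u' \<in> smooth_maps M real_line" "u' ` points M = u ` points M" "cover_map M u' \<in> ?G"
      and x: "x \<in> points M"
    show "\<bar>u' x - u x\<bar> < 1/4"
    proof (rule lifts_with_equal_image_close[OF M(3,2) _ _ u'(2) _ x])
      fix y assume "y \<in> points M"
      then obtain c K where cK: "(c, K) \<in> F" "y \<in> K" using F(3) by blast
      then have "cover_map M u' \<in> G (c, K)" using u'(3) by blast
      then show "\<exists>k::int. \<bar>u' y - u y - of_int k\<bar> < 1/4" using G(3)[OF cK(1)] cK(2) by simp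
    qed (intro smooth_map_real_line_continuous u u')+
  qed
qed

text \<open>
  Once the lifts are known to be uniformly close without integer ambiguity, both take values in the
  interval of the angle chart near a given point. There they are the angles of their composites, so
  their derivatives are those measured by the Whitney neighbourhood in the angle chart.
\<close>

lemma cover_map_nbhd_smooth_close:
  fixes M :: "('a, 'e::euclidean_space) manifold"
  assumes M: "smooth_manifold M" "compact_space (mfd_top M)" "connected_space (mfd_top M)"
    and u: "u \<in> smooth_maps M real_line"
    and c: "(U, \<phi>) \<in> mfd_charts M" and K: "compactin (mfd_top M) K" "K \<subseteq> U" and "\<delta> > 0"
  obtains G where "openin (whitney_topology M circle) G" "cover_map M u \<in> G"
    "\<And>u' y vs. u' \<in> smooth_maps M real_line \<Longrightarrow> u' ` points M = u ` points M \<Longrightarrow> cover_map M u' \<in> G \<Longrightarrow>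
       y \<in> \<phi> ` K \<Longrightarrow> set vs \<subseteq> Basis \<Longrightarrow> length vs \<le> r \<Longrightarrow>
       norm (partials (mfd_model M) (u \<circ> inv_into U \<phi>) vs y
           - partials (mfd_model M) (u' \<circ> inv_into U \<phi>) vs y) < \<delta>"
proof -
  let ?H = "mfd_model M"
  obtain G1 where G1: "openin (whitney_topology M circle) G1" "cover_map M u \<in> G1"
    and near: "\<And>u' x. u' \<in> smooth_maps M real_line \<Longrightarrow> u' ` points M = u ` points M \<Longrightarrow>
       cover_map M u' \<in> G1 \<Longrightarrow> x \<in> points M \<Longrightarrow> \<bar>u' x - u x\<bar> < 1/4"
    using cover_map_nbhd_close[OF M u] by blast
  \<comment> \<open>Two errors below \<open>1/4\<close> add up to less than \<open>1\<close> and so force an integer to vanish.\<close>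
  let ?\<delta> = "min \<delta> (1/4)"
  obtain G2 where G2: "openin (whitney_topology M circle) G2" "cover_map M u \<in> G2"
    and arcs: "\<And>w x. w \<in> G2 \<Longrightarrow> x \<in> K \<Longrightarrow> \<exists>C a. x \<in> C \<and> C \<subseteq> K \<and> u ` C \<subseteq> {a<..<a+1} \<and>
      w \<in> whitney_nbhd M circle (cover_map M u) {((U, \<phi>), C, (circle_arc a, arc_angle a), ?\<delta>)} r"
    using cover_map_nbhd[OF M(1) u c K, of ?\<delta> r] \<open>\<delta> > 0\<close> by auto
  show ?thesis
  proof (rule that[of "G1 \<inter> G2"])
    show "openin (whitney_topology M circle) (G1 \<inter> G2)" using G1 G2 by blast
    show "cover_map M u \<in> G1 \<inter> G2" using G1 G2 by blast
    fix u' y and vs :: "'e list"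
    assume u': "u' \<in> smooth_maps M real_line" "u' ` points M = u ` points M" "cover_map M u' \<in> G1 \<inter> G2"
      and y: "y \<in> \<phi> ` K" and vs: "set vs \<subseteq> Basis" "length vs \<le> r"
    obtain x where x: "x \<in> K" "y = \<phi> x" using y by blast
    obtain C a where C: "x \<in> C" "C \<subseteq> K" "u ` C \<subseteq> {a<..<a+1}"
      and w: "cover_map M u' \<in> whitney_nbhd M circle (cover_map M u) {((U, \<phi>), C, (circle_arc a, arc_angle a), ?\<delta>)} r"
      using arcs[OF _ x(1), of "cover_map M u'"] u'(3) by blast
    have CU: "C \<subseteq> U" and xU: "x \<in> U" "x \<in> points M"
      using C K(2) chart_subset[OF M(1) c] by auto
    have u'x: "u' x \<in> {a<..<a+1}"
    proof -
      obtain k :: int where k: "u' x + of_int k \<in> {a<..<a+1}" "\<bar>u' x + of_int k - u x\<bar> < ?\<delta>"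
        using whitney_nbhd_arcD[OF M(1) c CU C(1,3) w] by blast
      then have "\<bar>u' x + of_int k - u x\<bar> < 1/4" by simp
      moreover have "\<bar>u' x - u x\<bar> < 1/4" using near u' xU by blast
      ultimately have "\<bar>of_int k\<bar> < (1::real)" by linarith
      then have "k = 0" by linarith
      then show ?thesis using k(1) by simp
    qed
    have loc: "partials ?H (in_charts (U, \<phi>) (circle_arc a, arc_angle a) (cover_map M v)) vs y
        = partials ?H (v \<circ> inv_into U \<phi>) vs y"
      if v: "v \<in> smooth_maps M real_line" "v x \<in> {a<..<a+1}" for v
    proof (rule partials_cong_openin)
      show "openin (top_of_set ?H) (\<phi> ` (U \<inter> v -` {a<..<a+1}))"
        by (rule openin_chart_preimage[OF M(1) c smooth_map_real_line_continuous[OF v(1)]]) simp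
      show "y \<in> \<phi> ` (U \<inter> v -` {a<..<a+1})" using x xU v by blast
      fix y' assume "y' \<in> \<phi> ` (U \<inter> v -` {a<..<a+1})"
      then obtain x' where x': "x' \<in> U" "v x' \<in> {a<..<a+1}" "y' = \<phi> x'" by blast
      then have "x' \<in> points M" using chart_subset[OF M(1) c] by blast
      then show "in_charts (U, \<phi>) (circle_arc a, arc_angle a) (cover_map M v) y' = (v \<circ> inv_into U \<phi>) y'"
        using arc_angle_circle_cover[OF x'(2)] x'
        by (simp add: in_charts_def chart_inv_into_eq[OF M(1) c])
    qed
    have ux: "u x \<in> {a<..<a+1}" using C by blast
    have "y \<in> \<phi> ` C" using C(1) x(2) by blast
    then have "norm (partials ?H (in_charts (U, \<phi>) (circle_arc a, arc_angle a) (cover_map M u)) vs y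
        - partials ?H (in_charts (U, \<phi>) (circle_arc a, arc_angle a) (cover_map M u')) vs y) < ?\<delta>"
      using w vs unfolding whitney_nbhd_single by blast
    then show "norm (partials ?H (u \<circ> inv_into U \<phi>) vs y - partials ?H (u' \<circ> inv_into U \<phi>) vs y) < \<delta>"
      unfolding loc[OF u ux] loc[OF u'(1) u'x] by simp
  qed
qed

section \<open>The homeomorphism of orbits\<close>

lemma restrict_id_in_diffeos:
  assumes M: "smooth_manifold M"
  shows "restrict id (points M) \<in> diffeos M"
proof -
  let ?i = "restrict id (points M)"
  have "smooth_on (\<phi> ` (U \<inter> ?i -` V)) (in_charts (U, \<phi>) (V, \<psi>) ?i)"
    if c: "(U, \<phi>) \<in> mfd_charts M" and d: "(V, \<psi>) \<in> mfd_charts M" for U \<phi> V \<psi>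
  proof -
    have eq: "U \<inter> ?i -` V = U \<inter> V" using chart_subset[OF M c] by auto
    have "smooth_on (\<phi> ` (U \<inter> V)) (\<psi> \<circ> inv_into U \<phi>)"
      using smooth_manifold_chart(2)[OF M c d] by (simp add: compatible_def)
    then show ?thesis
      unfolding eq
    proof (rule smooth_on_cong)
      fix y assume "y \<in> \<phi> ` (U \<inter> V)"
      then obtain x where "x \<in> U" "y = \<phi> x" by blast
      moreover from this have "x \<in> points M" using chart_subset[OF M c] by blast
      ultimately show "(\<psi> \<circ> inv_into U \<phi>) y = in_charts (U, \<phi>) (V, \<psi>) ?i y"
        by (simp add: in_charts_def chart_inv_into_eq[OF M c])
    qed
  qed
  moreover have "continuous_map (mfd_top M) (mfd_top M) ?i"
    by (rule continuous_map_eq[OF continuous_map_id]) simp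
  ultimately have i: "?i \<in> smooth_maps M M" unfolding smooth_maps_def by auto
  have bij: "bij_betw ?i (points M) (points M)"
    using bij_betw_id[of "points M"] by (simp cong: bij_betw_cong)
  have "restrict (inv_into (points M) ?i) (points M) = ?i"
  proof (rule restrict_ext)
    fix x assume x: "x \<in> points M"
    then have "inv_into (points M) ?i (?i x) = x" by (intro inv_into_f_f bij_betw_imp_inj_on[OF bij])
    then show "inv_into (points M) ?i x = id x" using x by simp
  qed
  then show ?thesis using i bij by (simp add: diffeos_def)
qed

text \<open>
  All elements of an orbit have the same image, because diffeomorphisms are surjective. This is what
  distinguishes the lift of \<open>f \<circ> h\<close> in the orbit of \<open>f'\<close> from its integer translates.
\<close>

lemma orbit_image:
  assumes "u \<in> orbit M f"
  shows "u ` points M = f ` points M"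
proof -
  obtain h where "h \<in> diffeos M" "u = compose (points M) f h" using assms by (auto simp: orbit_def)
  moreover from this have "h ` points M = points M" by (simp add: diffeos_def bij_betw_def)
  moreover have "compose (points M) f h ` points M = f ` (h ` points M)"
    by (simp add: compose_def image_image)
  ultimately show ?thesis by simp
qed

lemma cover_map_compose:
  assumes "h \<in> diffeos M" "\<And>x. x \<in> points M \<Longrightarrow> circle_cover (f' x) = f x"
  shows "cover_map M (compose (points M) f' h) = compose (points M) f h"
proof
  fix x
  have "h x \<in> points M" if "x \<in> points M"
    using assms(1) that by (auto simp: diffeos_def bij_betw_def)
  then show "cover_map M (compose (points M) f' h) x = compose (points M) f h x"
    using assms(2) by (auto simp: compose_def restrict_def)
qed

text \<open>
  The inverse sends \<open>f \<circ> h\<close> to \<open>f' \<circ> h\<close>. It is continuous since neighbourhoods of \<open>f \<circ> h\<close> control the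
  derivatives of lifts with the right image in the identity chart of the line, and hence in any chart.
\<close>

lemma orbits_homeomorphic_map:
  fixes M :: "('a, 'e::euclidean_space) manifold"
  assumes M: "smooth_manifold M" "axis_thick (mfd_model M)" "compact_space (mfd_top M)"
    "connected_space (mfd_top M)"
    and lift: "universal_lift M f f'"
  shows "homeomorphic_map (orbit_topology M real_line f') (orbit_topology M circle f) (cover_map M)"
proof -
  have f': "f' \<in> smooth_maps M real_line" and ff': "\<And>x. x \<in> points M \<Longrightarrow> circle_cover (f' x) = f x"
    using lift by (simp_all add: universal_lift_def)
  let ?X = "orbit_topology M real_line f'" and ?Y = "orbit_topology M circle f"
  have X: "topspace ?X = smooth_maps M real_line \<inter> orbit M f'"
    and Y: "topspace ?Y = smooth_maps M circle \<inter> orbit M f"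
    by (simp_all add: orbit_topology_def topspace_whitney_topology)
  have cover: "cover_map M u \<in> topspace ?Y" if u: "u \<in> topspace ?X" for u
  proof -
    obtain h where h: "h \<in> diffeos M" "u = compose (points M) f' h"
      using u unfolding X orbit_def by blast
    then have "cover_map M u = compose (points M) f h" using cover_map_compose ff' by blast
    then have "cover_map M u \<in> orbit M f" unfolding orbit_def using h(1) by blast
    then show ?thesis using cover_map_smooth[OF M(1)] that unfolding X Y by blast
  qed
  have inj: "u = v" if "u \<in> topspace ?X" "v \<in> topspace ?X" "cover_map M u = cover_map M v" for u v
    using that orbit_image[of u M f'] orbit_image[of v M f'] unfolding X
    by (intro cover_map_injective[OF M(4,3)]) auto
  have surj: "\<exists>u\<in>topspace ?X. cover_map M u = w" if w: "w \<in> topspace ?Y" for w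
  proof -
    obtain h where h: "h \<in> diffeos M" "w = compose (points M) f h"
      using w unfolding Y orbit_def by blast
    let ?u = "compose (points M) f' h"
    have w_eq: "cover_map M ?u = w" using cover_map_compose[OF h(1)] ff' h(2) by blast
    have "h \<in> smooth_maps M M" using h(1) by (simp add: diffeos_def)
    then have "continuous_map (mfd_top M) euclideanreal (f' \<circ> h)"
      using smooth_mapsD(2) smooth_map_real_line_continuous[OF f'] continuous_map_compose by blast
    then have "continuous_map (mfd_top M) euclideanreal ?u"
      by (rule continuous_map_eq) (simp add: compose_def)
    moreover have "?u \<in> extensional (points M)" by (simp add: compose_def)
    ultimately have "?u \<in> smooth_maps M real_line"
      using smooth_map_circle_iff[OF M(1), of ?u] w w_eq unfolding Y by simp
    moreover have "?u \<in> orbit M f'" using h(1) unfolding orbit_def by blast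
    ultimately show ?thesis using w_eq unfolding X by blast
  qed
  define lf where "lf = inv_into (topspace ?X) (cover_map M)"
  have inj_on: "inj_on (cover_map M) (topspace ?X)" using inj by (intro inj_onI)
  have lf_cover: "lf (cover_map M u) = u" if "u \<in> topspace ?X" for u
    unfolding lf_def by (rule inv_into_f_f[OF inj_on that])
  have lf: "lf w \<in> topspace ?X" "cover_map M (lf w) = w" if "w \<in> topspace ?Y" for w
    using surj[OF that] lf_cover by auto
  have "continuous_map ?X ?Y (cover_map M)"
  proof -
    have "continuous_map ?X (whitney_topology M circle) (cover_map M)"
      unfolding orbit_topology_def
      by (rule continuous_map_from_subtopology[OF continuous_map_cover_map[OF M(1,2,3)]])
    moreover have "cover_map M ` topspace ?X \<subseteq> orbit M f" using cover unfolding Y by blast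
    ultimately show ?thesis
      unfolding orbit_topology_def[of M circle f] by (auto simp: continuous_map_in_subtopology)
  qed
  moreover have "continuous_map ?Y (whitney_topology M real_line) lf"
  proof (rule continuous_map_into_whitney_topology[OF M(1-3) openin_real_line_chart])
    show "lf w \<in> smooth_maps M real_line" if "w \<in> topspace ?Y" for w
      using lf[OF that] unfolding X by blast
  next
    fix w U \<phi> K V \<psi> r and \<epsilon> :: real
    assume w: "w \<in> topspace ?Y" and c: "(U, \<phi>) \<in> mfd_charts M"
      and d: "(V, \<psi>) \<in> mfd_charts real_line" and K: "compactin (mfd_top M) K" "K \<subseteq> U"
      and KV: "lf w ` K \<subseteq> V" and "\<epsilon> > 0"
    let ?H = "mfd_model M"
    define u where "u = lf w"
    have u: "u \<in> smooth_maps M real_line" "u \<in> orbit M f'" "cover_map M u = w"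
      using lf[OF w] unfolding X u_def by auto
    have a: "smooth_within ?H (\<phi> ` U) (u' \<circ> inv_into U \<phi>)" if "u' \<in> smooth_maps M real_line" for u'
      by (rule smooth_within_real_line[OF M(1,2) that c])
    have \<phi>K: "compact (\<phi> ` K)" "\<phi> ` K \<subseteq> \<phi> ` U"
      using chart_compact_image[OF M(1) c K] K(2) by auto
    have im: "(u \<circ> inv_into U \<phi>) ` (\<phi> ` K) \<subseteq> V"
    proof
      fix s assume "s \<in> (u \<circ> inv_into U \<phi>) ` (\<phi> ` K)"
      then obtain x where x: "x \<in> K" "s = u x" using K(2) by (auto simp: chart_inv_into_eq[OF M(1) c])
      then show "s \<in> V" using KV unfolding u_def by blast
    qed
    obtain \<delta> r' where "\<delta> > 0" and
      *: "\<And>b x. smooth_within ?H (\<phi> ` U) b \<Longrightarrow>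
         (\<And>x vs. x \<in> \<phi> ` K \<Longrightarrow> set vs \<subseteq> Basis \<Longrightarrow> length vs \<le> r' \<Longrightarrow>
            norm (partials ?H (u \<circ> inv_into U \<phi>) vs x - partials ?H b vs x) < \<delta>) \<Longrightarrow> x \<in> \<phi> ` K \<Longrightarrow>
         b x \<in> V \<and> (\<forall>vs. set vs \<subseteq> Basis \<and> length vs \<le> r \<longrightarrow>
           norm (partials ?H (\<psi> \<circ> (u \<circ> inv_into U \<phi>)) vs x - partials ?H (\<psi> \<circ> b) vs x) < \<epsilon>)"
      using smooth_close_compose[OF M(2) \<phi>K a[OF u(1)] real_line_chart_smooth[OF d] im \<open>\<epsilon> > 0\<close>] by metis
    obtain G where G: "openin (whitney_topology M circle) G" "cover_map M u \<in> G" and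
      close: "\<And>u' y vs. u' \<in> smooth_maps M real_line \<Longrightarrow> u' ` points M = u ` points M \<Longrightarrow>
         cover_map M u' \<in> G \<Longrightarrow> y \<in> \<phi> ` K \<Longrightarrow> set vs \<subseteq> Basis \<Longrightarrow> length vs \<le> r' \<Longrightarrow>
         norm (partials ?H (u \<circ> inv_into U \<phi>) vs y - partials ?H (u' \<circ> inv_into U \<phi>) vs y) < \<delta>"
      using cover_map_nbhd_smooth_close[OF M(1,3,4) u(1) c K \<open>\<delta> > 0\<close>] by metis
    have "lf w' \<in> whitney_nbhd M real_line u {((U, \<phi>), K, (V, \<psi>), \<epsilon>)} r"
      if w': "w' \<in> G \<inter> topspace ?Y" for w'
    proof -
      define u' where "u' = lf w'"
      have u': "u' \<in> smooth_maps M real_line" "u' \<in> orbit M f'" "cover_map M u' = w'"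
        using lf[of w'] w' unfolding X u'_def by auto
      have im_eq: "u' ` points M = u ` points M"
        using orbit_image[OF u'(2)] orbit_image[OF u(2)] by simp
      have "cover_map M u' \<in> G" using u'(3) w' by simp
      note ** = *[OF a[OF u'(1)] close[OF u'(1) im_eq this]]
      show ?thesis
        unfolding whitney_nbhd_single u'_def[symmetric]
      proof (intro conjI ballI allI impI)
        show "u' \<in> smooth_maps M real_line" by (rule u')
        show "u' ` K \<subseteq> V"
        proof
          fix s assume "s \<in> u' ` K"
          then obtain x where x: "x \<in> K" "s = u' x" by blast
          then have "x \<in> U" using K(2) by blast
          then show "s \<in> V" using **[of "\<phi> x"] x by (simp add: chart_inv_into_eq[OF M(1) c])
        qed
        fix y and vs :: "'e list"
        assume y: "y \<in> \<phi> ` K" and vs: "set vs \<subseteq> Basis \<and> length vs \<le> r"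
        show "norm (partials ?H (in_charts (U, \<phi>) (V, \<psi>) u) vs y -
            partials ?H (in_charts (U, \<phi>) (V, \<psi>) u') vs y) < \<epsilon>"
          using **[OF _ _ _ y] vs unfolding in_charts_def split comp_assoc by blast
      qed
    qed
    moreover have "openin ?Y (G \<inter> topspace ?Y)"
      using G(1) unfolding Y unfolding orbit_topology_def openin_subtopology
      by (intro exI[of _ G]) (use openin_subset[OF G(1)] in \<open>auto simp: topspace_whitney_topology\<close>)
    ultimately show "\<exists>G. openin ?Y G \<and> w \<in> G \<and>
        (\<forall>y\<in>G. lf y \<in> whitney_nbhd M real_line (lf w) {((U, \<phi>), K, (V, \<psi>), \<epsilon>)} r)"
      using w G(2) u(3) unfolding u_def by (intro exI[of _ "G \<inter> topspace ?Y"]) simp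
  qed
  then have "continuous_map ?Y ?X lf"
    using lf(1) unfolding X orbit_topology_def
    by (intro continuous_map_into_subtopology) (auto simp: Y[unfolded orbit_topology_def])
  ultimately have "homeomorphic_maps ?X ?Y (cover_map M) lf"
    unfolding homeomorphic_maps_def using lf_cover lf(2) by blast
  then show ?thesis unfolding homeomorphic_map_maps by blast
qed

theorem proposition3p2:
  fixes M :: "('a, real \<times> real) manifold"
    and f :: "'a \<Rightarrow> complex" and f' :: "'a \<Rightarrow> real"
  assumes "smooth_surface M"
    and "compact_space (mfd_top M)"
    and "connected_space (mfd_top M)"
    and "f \<in> class_F M circle"
    and "null_homotopic M circle f"
    and "universal_lift M f f'"
  shows "orbit_topology M circle f homeomorphic_space orbit_topology M real_line f' \<and>
    orbit_component_topology M circle f homeomorphic_space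
      orbit_component_topology M real_line f'"
proof -
  have M: "smooth_manifold M" "axis_thick (mfd_model M)"
    using assms(1) axis_thick_half_plane by (simp_all add: smooth_surface_def)
  let ?X = "orbit_topology M real_line f'" and ?Y = "orbit_topology M circle f"
  have hom: "homeomorphic_map ?X ?Y (cover_map M)"
    by (rule orbits_homeomorphic_map[OF M assms(2,3,6)])
  have f': "f' \<in> smooth_maps M real_line" "\<And>x. x \<in> points M \<Longrightarrow> circle_cover (f' x) = f x"
    using assms(6) by (simp_all add: universal_lift_def)
  have f: "f \<in> extensional (points M)"
    using assms(4) smooth_mapsD(1) unfolding class_F_def by blast
  have base: "cover_map M f' = f"
    by (rule extensionalityI[OF _ f]) (simp_all add: f'(2))
  have "f' = compose (points M) f' (restrict id (points M))"
    by (rule extensionalityI[OF smooth_mapsD(1)[OF f'(1)]]) (simp_all add: compose_def)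
  then have "f' \<in> orbit M f'" using restrict_id_in_diffeos[OF M(1)] unfolding orbit_def by blast
  then have f'X: "f' \<in> topspace ?X"
    using f'(1) by (simp add: orbit_topology_def topspace_whitney_topology)
  let ?A = "connected_component_of_set ?X f'" and ?B = "connected_component_of_set ?Y f"
  have "cover_map M ` ?A = ?B"
    using homeomorphic_map_connected_component_of[OF hom f'X] unfolding base by simp
  then have "homeomorphic_map (subtopology ?X ?A) (subtopology ?Y ?B) (cover_map M)"
    using connected_component_of_subset_topspace[of ?X f'] connected_component_of_subset_topspace[of ?Y f]
    by (intro homeomorphic_map_subtopologies[OF hom]) (simp add: Int_absorb1)
  then show ?thesis
    using homeomorphic_map_imp_homeomorphic_space[OF hom] homeomorphic_map_imp_homeomorphic_space
    unfolding orbit_component_topology_def by (meson homeomorphic_space_sym)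
qed

end
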